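(* Let $d\ge 1$ be an integer, let $\lambda>0$ and $\alpha>d$, and let $(W_x)_{x\in\mathbb{Z}^d}$ be i.i.d. non-negative random variables with common distribution function $F$ satisfying $$1-F(w)=\mathbb{P}(W_0>w)=w^{-(\tau-1)}L(w),\qquad w>0,$$ where $L$ is slowly varying at infinity, and suppose that $\gamma:=\alpha(\tau-1)/d>1$. Consider the random graph on $\mathbb{Z}^d$ in which, conditionally on $(W_x)_{x\in\mathbb{Z}^d}$, the edges between distinct vertices $x,y$ are independently present with probability $p_{xy}=1-\exp\{-\lambda W_xW_y/|x-y|^{\alpha}\}$, and let $D_0$ be the degree of the vertex $0$. Then there exists a function $s\mapsto \ell(s)$, slowly varying at infinity, such that $$\mathbb{P}(D_0>s)=s^{-\gamma}\ell(s),\qquad s>0.$$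
   Context: $|\cdot|$ denotes the Euclidean norm on $\mathbb{R}^d$. The graph has vertex set $\mathbb{Z}^d$, and each unordered pair of distinct vertices is a potential edge. The degree $D_0$ is the number of vertices $y\ne 0$ for which the edge $(0,y)$ is present. A function $L$ that is positive for all large arguments is slowly varying at infinity if $L(aw)/L(w)\to 1$ as $w\to\infty$ for every $a>0$. *)

theory Defs
  imports "HOL-Probability.Probability"
begin

definition slowly_varying :: "(real \<Rightarrow> real) \<Rightarrow> bool" where
  "slowly_varying L \<longleftrightarrow>
     (\<forall>\<^sub>F w in at_top. 0 < L w) \<and>
     (\<forall>a>0. ((\<lambda>w. L (a * w) / L w) \<longlongrightarrow> 1) at_top)"

text \<open>The lattice \<open>\<int>\<^sup>d\<close> is the type \<open>int ^ 'd\<close> with \<open>d = CARD('d) \<ge> 1\<close>.\<close>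

definition lattice_dist :: "int ^ 'd::finite \<Rightarrow> int ^ 'd \<Rightarrow> real" where
  "lattice_dist x y = norm ((\<chi> i. real_of_int (x $ i - y $ i)) :: real ^ 'd)"

text \<open>An undirected edge is the two-element set of its end vertices.\<close>

definition potential_edges :: "'v set set" where
  "potential_edges = {{x, y} | x y. x \<noteq> y}"

text \<open>The degree takes the value \<open>\<infinity>\<close> for infinitely many neighbours, where \<open>card\<close> would
  give 0.\<close>

definition vertex_degree :: "'v set set \<Rightarrow> 'v \<Rightarrow> enat" where
  "vertex_degree G x =
     (let N = {y. y \<noteq> x \<and> {x, y} \<in> G} in if finite N then enat (card N) else \<infinity>)"

definition generated_sigma :: "'a measure \<Rightarrow> ('i \<Rightarrow> 'a \<Rightarrow> real) \<Rightarrow> 'a measure" where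
  "generated_sigma M W =
     vimage_algebra (space M) (\<lambda>\<omega> i. W i \<omega>) (Pi\<^sub>M UNIV (\<lambda>_. borel))"

text \<open>A version of \<open>\<P>(A | N)\<close>, determined up to null sets when \<open>N\<close> is a sub-sigma-algebra of
  \<open>M\<close>.\<close>

definition cond_prob_given :: "'a measure \<Rightarrow> 'a measure \<Rightarrow> 'a set \<Rightarrow> 'a \<Rightarrow> real" where
  "cond_prob_given M N A = real_cond_exp M N (indicator A)"

definition cond_indep_events ::
  "'a measure \<Rightarrow> 'a measure \<Rightarrow> ('i \<Rightarrow> 'a set) \<Rightarrow> 'i set \<Rightarrow> bool" where
  "cond_indep_events M N A I \<longleftrightarrow>
     (\<forall>i\<in>I. A i \<in> sets M) \<and>
     (\<forall>J\<subseteq>I. J \<noteq> {} \<longrightarrow> finite J \<longrightarrow>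
        (AE \<omega> in M. cond_prob_given M N (\<Inter>i\<in>J. A i) \<omega> = (\<Prod>i\<in>J. cond_prob_given M N (A i) \<omega>)))"

end

theory Submission
  imports Defs
begin

text \<open>
  Write \<open>p = d / \<alpha>\<close>, so that \<open>0 < p < 1\<close> and \<open>\<gamma> = (\<tau> - 1) / p\<close>. Given \<open>W\<^sub>0 = w\<close>, the edges at the
  vertex 0 are independent, because each of them depends on its own weight \<open>W\<^sub>x\<close>. The degree is then
  a sum of independent indicators with mean
  \<open>m(w) = \<Sum>\<^sub>x E[1 - exp (-\<lambda> w W / |x|\<^sup>\<alpha>)]\<close>, and it is exponentially concentrated around \<open>m(w)\<close>.
  Two facts give the theorem.

  First, \<open>m(w) \<sim> C w\<^sup>p\<close> with \<open>0 < C < \<infinity>\<close> (lemma \<open>expected_degree\<close>). The number \<open>1 - exp (-a)\<close> is the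
  probability that a standard exponential variable \<open>T\<close> lies below \<open>a\<close>. Hence
  \<open>m(w) = E[N (\<lambda> w W / T)]\<close>, where \<open>N(y)\<close> is the number of lattice points \<open>x \<noteq> 0\<close> with
  \<open>|x|\<^sup>\<alpha> < y\<close>. Comparison of a ball with unit cubes gives \<open>N(y) \<sim> v y\<^sup>p\<close>, where \<open>v\<close> is the volume of
  the unit ball, and dominated convergence gives
  \<open>C = v E[T\<^sup>-\<^sup>p] E[(\<lambda>W)\<^sup>p] = v \<Gamma>(1 - p) E[(\<lambda>W)\<^sup>p]\<close>. The Gamma value is finite since \<open>\<alpha> > d\<close>, and
  the moment is finite since \<open>\<gamma> > 1\<close> means \<open>p < \<tau> - 1\<close>.

  Second, the Chernoff bounds (lemma \<open>degree_tail_bounds\<close>) state that, for all \<open>s\<close>, \<open>w\<close> and \<open>t > 0\<close>,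
  \<open>P(D\<^sub>0 > s)\<close> is at most \<open>P(W\<^sub>0 > w) + exp ((e\<^sup>t - 1) m(w) - t s)\<close> and at least
  \<open>P(W\<^sub>0 > w) (1 - exp (t s - (1 - e\<^sup>-\<^sup>t) m(w)))\<close>. With \<open>w\<close> chosen so that \<open>m(w)\<close> is about
  \<open>(1 - \<epsilon>) s\<close>, respectively \<open>(1 + \<epsilon>) s\<close>, and with \<open>t\<close> of order \<open>\<epsilon>\<close>, the exponential terms decay
  exponentially in \<open>s\<close>, while the tail of \<open>W\<^sub>0\<close> decays only polynomially. So
  \<open>P(D\<^sub>0 > s) \<sim> P(W\<^sub>0 > (s / C)\<^bsup>1/p\<^esup>)\<close>, which is regularly varying of index \<open>-(\<tau> - 1) / p = -\<gamma>\<close>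
  (lemma \<open>regular_tail_transfer\<close>).
\<close>

section \<open>Counting lattice points in balls\<close>

lemma finite_bounded_lattice: "finite {x :: int ^ 'd::finite. lattice_dist 0 x < r}"
proof -
  let ?A = "{- \<lceil>r\<rceil> .. \<lceil>r\<rceil>}"
  have "{x :: int ^ 'd. lattice_dist 0 x < r} \<subseteq> vec_lambda ` (PiE UNIV (\<lambda>_. ?A))"
  proof
    fix x :: "int ^ 'd" assume "x \<in> {x. lattice_dist 0 x < r}"
    then have n: "norm ((\<chi> i. real_of_int (- x $ i)) :: real ^ 'd) < r"
      by (simp add: lattice_dist_def)
    have "x $ i \<in> ?A" for i
    proof -
      have "\<bar>real_of_int (x $ i)\<bar> < r"
        using component_le_norm_cart[of "(\<chi> i. real_of_int (- x $ i)) :: real ^ 'd" i] n by simp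
      then show ?thesis by (simp add: abs_less_iff) linarith
    qed
    then have "(\<lambda>i. x $ i) \<in> PiE UNIV (\<lambda>_. ?A)" by auto
    then show "x \<in> vec_lambda ` (PiE UNIV (\<lambda>_. ?A))"
      by (metis image_eqI vec_nth_inverse)
  qed
  then show ?thesis by (rule finite_subset) (intro finite_imageI finite_PiE; simp)
qed

definition unit_cube :: "int ^ 'd::finite \<Rightarrow> (real ^ 'd) set" where
  "unit_cube x = {y. \<forall>i. \<lfloor>y $ i\<rfloor> = x $ i}"

lemma sets_unit_cube: "unit_cube (x :: int ^ 'd::finite) \<in> sets lborel"
  and emeasure_unit_cube: "emeasure lborel (unit_cube x) = 1"
proof -
  let ?a = "(\<chi> i. real_of_int (x $ i)) :: real ^ 'd"
  let ?b = "(\<chi> i. real_of_int (x $ i) + 1) :: real ^ 'd"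
  have eq: "unit_cube x = (\<Inter>i. {y. real_of_int (x $ i) \<le> y $ i \<and> y $ i < real_of_int (x $ i) + 1})"
    by (auto simp: unit_cube_def floor_eq_iff)
  show m: "unit_cube x \<in> sets lborel"
    unfolding eq by (auto intro!: sets.countable_INT'')
  have "(\<Prod>b\<in>Basis. (?b - ?a) \<bullet> b) = 1"
  proof -
    have "?b - ?a = (\<chi> i. 1)" by (simp add: vec_eq_iff)
    then have "(?b - ?a) \<bullet> b = 1" if "b \<in> Basis" for b
      using that by (auto simp: Basis_vec_def inner_axis)
    then show ?thesis by simp
  qed
  moreover have "?a \<bullet> b \<le> ?b \<bullet> b" if "b \<in> Basis" for b
    using that by (auto simp: Basis_vec_def inner_axis)
  ultimately have 1: "emeasure lborel (box ?a ?b) = 1" "emeasure lborel (cbox ?a ?b) = 1"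
    by (simp_all add: emeasure_lborel_box emeasure_lborel_cbox)
  have "box ?a ?b \<subseteq> unit_cube x" "unit_cube x \<subseteq> cbox ?a ?b"
    by (auto simp: eq mem_box_cart intro: less_imp_le) (meson less_imp_le)
  then have "emeasure lborel (box ?a ?b) \<le> emeasure lborel (unit_cube x)"
     "emeasure lborel (unit_cube x) \<le> emeasure lborel (cbox ?a ?b)"
    using m by (auto intro!: emeasure_mono)
  then show "emeasure lborel (unit_cube x) = 1" using 1 by simp
qed

lemma unit_cube_near: 
  assumes "y \<in> unit_cube (x :: int ^ 'd::finite)"
  shows "\<bar>norm y - lattice_dist 0 x\<bar> \<le> real CARD('d)"
proof -
  let ?a = "(\<chi> i. real_of_int (x $ i)) :: real ^ 'd"
  have "lattice_dist 0 x = norm (- ?a)"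
    unfolding lattice_dist_def by (rule arg_cong[where f=norm]) (simp add: vec_eq_iff)
  then have "\<bar>norm y - lattice_dist 0 x\<bar> \<le> norm (y - ?a)"
    by (simp add: norm_triangle_ineq3)
  also have "\<dots> \<le> (\<Sum>i\<in>UNIV. \<bar>(y - ?a) $ i\<bar>)" by (rule norm_le_l1_cart)
  also have "\<dots> \<le> (\<Sum>i\<in>(UNIV::'d set). 1)"
  proof (rule sum_mono)
    fix i
    have "\<lfloor>y $ i\<rfloor> = x $ i" using assms by (simp add: unit_cube_def)
    then show "\<bar>(y - ?a) $ i\<bar> \<le> 1" by (simp add: abs_le_iff) linarith
  qed
  finally show ?thesis by simp
qed

text \<open>The cubes at the lattice points of norm below \<open>r\<close> have total volume \<open>n\<close>. Each point of
  such a cube is within distance \<open>d\<close> of its lattice point, so the union of the cubes contains the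
  ball of radius \<open>r - d\<close> and lies in the ball of radius \<open>r + d\<close>.\<close>

lemma lattice_ball_count:
  fixes r :: real
  defines "n \<equiv> card {x :: int ^ 'd::finite. lattice_dist 0 x < r}"
    and "v \<equiv> unit_ball_vol (real CARD('d))" and "d \<equiv> CARD('d)"
  shows "v * (max 0 (r - real d)) ^ d \<le> real n" "r \<ge> 0 \<Longrightarrow> real n \<le> v * (r + real d) ^ d"
proof -
  let ?A = "{x :: int ^ 'd. lattice_dist 0 x < r}"
  let ?U = "\<Union>x\<in>?A. unit_cube x"
  have fin: "finite ?A" by (rule finite_bounded_lattice)
  have disj: "disjoint_family_on unit_cube ?A"
    by (auto simp: disjoint_family_on_def unit_cube_def vec_eq_iff)
  have Us: "?U \<in> sets lborel" by (intro sets.finite_UN fin sets_unit_cube)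
  have "emeasure lborel ?U = (\<Sum>x\<in>?A. emeasure lborel (unit_cube x))"
    by (rule sum_emeasure[symmetric]) (use fin disj sets_unit_cube in auto)
  then have U: "emeasure lborel ?U = of_nat n"
    by (simp add: emeasure_unit_cube n_def)
  have ball: "emeasure lborel (ball (0::real^'d) \<rho>) = ennreal (v * \<rho> ^ d)" if "\<rho> \<ge> 0" for \<rho>
    using that emeasure_ball[of \<rho> "0::real^'d"] by (simp add: v_def d_def)
  have v0: "v \<ge> 0" by (simp add: v_def)
  show "v * (max 0 (r - real d)) ^ d \<le> real n"
  proof -
    have "ball 0 (max 0 (r - real d)) \<subseteq> ?U"
    proof
      fix y :: "real ^ 'd" assume "y \<in> ball 0 (max 0 (r - real d))"
      then have y: "norm y < r - real d" by (auto simp: max_def split: if_splits)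
      let ?x = "(\<chi> i. \<lfloor>y $ i\<rfloor>) :: int ^ 'd"
      have 1: "y \<in> unit_cube ?x" by (simp add: unit_cube_def)
      from unit_cube_near[OF 1] y have "lattice_dist 0 ?x < r" by (simp add: d_def)
      with 1 show "y \<in> ?U" by blast
    qed
    then have "emeasure lborel (ball (0::real^'d) (max 0 (r - real d))) \<le> of_nat n"
      unfolding U[symmetric] using Us by (intro emeasure_mono) auto
    then show ?thesis
      by (subst (asm) ball) (auto simp: ennreal_of_nat_eq_real_of_nat)
  qed
  show "real n \<le> v * (r + real d) ^ d" if r: "r \<ge> 0"
  proof -
    have "?U \<subseteq> ball 0 (r + real d)"
    proof
      fix y assume "y \<in> ?U"
      then obtain x where "lattice_dist 0 x < r" "y \<in> unit_cube x" by auto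
      with unit_cube_near[OF this(2)] show "y \<in> ball 0 (r + real d)" by (simp add: d_def)
    qed
    then have "of_nat n \<le> emeasure lborel (ball (0::real^'d) (r + real d))"
      unfolding U[symmetric] by (intro emeasure_mono) auto
    then have "ennreal (real n) \<le> ennreal (v * (r + real d) ^ d)"
      using r by (subst (asm) ball) (auto simp: ennreal_of_nat_eq_real_of_nat)
    then show ?thesis using v0 r by (subst (asm) ennreal_le_iff) auto
  qed
qed

lemma lattice_dist_ge_1:
  assumes "x \<noteq> (0 :: int ^ 'd::finite)" shows "lattice_dist 0 x \<ge> 1"
proof -
  obtain i where i: "x $ i \<noteq> 0" using assms by (auto simp: vec_eq_iff)
  then have "1 \<le> \<bar>real_of_int (x $ i)\<bar>" by linarith
  also have "\<dots> \<le> lattice_dist 0 x"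
    using component_le_norm_cart[of "(\<chi> i. real_of_int (- x $ i)) :: real ^ 'd" i]
    by (simp add: lattice_dist_def)
  finally show ?thesis .
qed

text \<open>Counting by the value of \<open>|x|\<^sup>\<alpha>\<close> rather than of \<open>|x|\<close> gives a function that is monotone on
  the whole real line, and for which the relevant scale is the strength of the edges.\<close>

definition lattice_count :: "('d::finite) itself \<Rightarrow> real \<Rightarrow> real \<Rightarrow> real" where
  "lattice_count _ \<alpha> y = real (card {x :: int ^ 'd. x \<noteq> 0 \<and> lattice_dist 0 x powr \<alpha> < y})"

lemma finite_lattice_powr:
  assumes "\<alpha> > 0"
  shows "finite {x :: int ^ 'd::finite. x \<noteq> 0 \<and> lattice_dist 0 x powr \<alpha> < y}"
proof (rule finite_subset)
  show "{x :: int ^ 'd. x \<noteq> 0 \<and> lattice_dist 0 x powr \<alpha> < y} \<subseteq> {x. lattice_dist 0 x < y powr (1/\<alpha>)}"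
  proof safe
    fix x :: "int ^ 'd" assume x: "x \<noteq> 0" "lattice_dist 0 x powr \<alpha> < y"
    have "(lattice_dist 0 x powr \<alpha>) powr (1/\<alpha>) < y powr (1/\<alpha>)"
      using x assms by (intro powr_less_mono2) auto
    then show "lattice_dist 0 x < y powr (1/\<alpha>)"
      using assms lattice_dist_ge_1[OF x(1)] by (simp add: powr_powr)
  qed
qed (rule finite_bounded_lattice)

lemma filterlim_powr_at_top:
  assumes "c > (0::real)"
  shows "filterlim (\<lambda>x. x powr c) at_top at_top"
proof -
  have "filterlim (\<lambda>x. exp (c * ln x)) at_top at_top"
    by (rule filterlim_compose[OF exp_at_top],
        rule filterlim_tendsto_pos_mult_at_top[OF tendsto_const assms ln_at_top])
  moreover have "\<forall>\<^sub>F x in at_top. x powr c = exp (c * ln x)"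
    using eventually_gt_at_top[of 0] by eventually_elim (simp add: powr_def)
  ultimately show ?thesis using filterlim_cong by fastforce
qed

lemma lattice_count_mono: "\<alpha> > 0 \<Longrightarrow> mono (lattice_count TYPE('d::finite) \<alpha>)"
  unfolding lattice_count_def 
  by (intro monoI of_nat_mono card_mono finite_lattice_powr) auto

text \<open>The origin is always in the ball and never counted, hence the shift by one.\<close>

lemma lattice_count_eq:
  assumes "\<alpha> > 0" "y > 0"
  shows "lattice_count TYPE('d::finite) \<alpha> y 
     = real (card {x :: int ^ 'd::finite. lattice_dist 0 x < y powr (1/\<alpha>)}) - 1"
proof -
  have iff: "lattice_dist 0 x powr \<alpha> < y \<longleftrightarrow> lattice_dist 0 x < y powr (1/\<alpha>)" 
    if "x \<noteq> 0" for x :: "int ^ 'd"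
  proof -
    have "lattice_dist 0 x powr \<alpha> < (y powr (1/\<alpha>)) powr \<alpha> \<longleftrightarrow> lattice_dist 0 x < y powr (1/\<alpha>)"
      using lattice_dist_ge_1[OF that] assms 
      by (meson less_eq_real_def linorder_not_le order_trans powr_ge_zero powr_less_mono2 powr_mono2 zero_le_one)
    then show ?thesis using assms by (simp add: powr_powr)
  qed
  let ?A = "{x :: int ^ 'd::finite. lattice_dist 0 x < y powr (1/\<alpha>)}"
  have 0: "0 \<in> ?A" using assms by (simp add: lattice_dist_def norm_eq_zero[THEN iffD2] vec_eq_iff)
  have "{x :: int ^ 'd. x \<noteq> 0 \<and> lattice_dist 0 x powr \<alpha> < y} = ?A - {0}"
    using iff by auto
  moreover have "card ?A \<ge> 1" using 0 finite_bounded_lattice[of "y powr (1/\<alpha>)", where 'd='d]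
    by (metis One_nat_def Suc_leI card_gt_0_iff empty_iff)
  ultimately show ?thesis
    unfolding lattice_count_def using 0 by (simp add: card_Diff_singleton of_nat_diff)
qed

lemma lattice_count_bound:
  assumes "\<alpha> > 0"
  shows "\<exists>K. \<forall>y\<ge>0. lattice_count TYPE('d::finite) \<alpha> y \<le> K * y powr (real CARD('d) / \<alpha>)"
proof (intro exI allI impI)
  let ?d = "CARD('d)" let ?v = "unit_ball_vol (real CARD('d))"
  let ?K = "?v * (1 + real ?d) ^ ?d"
  fix y :: real assume "y \<ge> 0"
  \<comment> \<open>No bound of the form \<open>(r + d)\<^sup>d \<le> K r\<^sup>d\<close> holds for small \<open>r\<close>, but nonzero lattice points have
    norm at least 1, so nothing is counted there.\<close>
  show "lattice_count TYPE('d) \<alpha> y \<le> ?K * y powr (real ?d / \<alpha>)"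
  proof (cases "y \<ge> 1")
    case False
    have "{x :: int ^ 'd. x \<noteq> 0 \<and> lattice_dist 0 x powr \<alpha> < y} = {}"
    proof safe
      fix x :: "int ^ 'd" assume x: "x \<noteq> 0" "lattice_dist 0 x powr \<alpha> < y"
      from lattice_dist_ge_1[OF x(1)] assms have "lattice_dist 0 x powr \<alpha> \<ge> 1"
        by (simp add: ge_one_powr_ge_zero)
      with x(2) False show "x \<in> {}" by simp
    qed
    then have "lattice_count TYPE('d) \<alpha> y = 0" by (simp add: lattice_count_def del: Collect_empty_eq)
    then show ?thesis by simp
  next
    case True
    define r where "r = y powr (1/\<alpha>)"
    have r: "r \<ge> 1" using True assms by (simp add: r_def ge_one_powr_ge_zero)
    have "lattice_count TYPE('d) \<alpha> y \<le> ?v * (r + real ?d) ^ ?d"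
      using lattice_ball_count(2)[of r, where 'd='d] lattice_count_eq[of \<alpha> y, where 'd='d] True assms r
      by (simp add: r_def)
    also have "\<dots> \<le> ?v * ((1 + real ?d) * r) ^ ?d"
    proof -
      have "real ?d * 1 \<le> real ?d * r" using r by (intro mult_left_mono) auto
      then show ?thesis using r by (intro mult_left_mono power_mono) (auto simp: algebra_simps)
    qed
    also have "\<dots> = ?K * r ^ ?d" by (simp add: power_mult_distrib)
    also have "r ^ ?d = y powr (real ?d / \<alpha>)"
      using True by (simp add: r_def powr_powr flip: powr_realpow)
    finally show ?thesis .
  qed
qed

lemma lattice_count_asymp:
  assumes "\<alpha> > 0"
  shows "((\<lambda>y. lattice_count TYPE('d::finite) \<alpha> y / y powr (real CARD('d) / \<alpha>)) 
     \<longlongrightarrow> unit_ball_vol (real CARD('d))) at_top"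
proof -
  let ?d = "CARD('d)" let ?v = "unit_ball_vol (real CARD('d))"
  let ?N = "\<lambda>r. card {x :: int ^ 'd::finite. lattice_dist 0 x < r}"
  have d0: "?d > 0" by simp
  have inv: "((\<lambda>r. c / r) \<longlongrightarrow> 0) at_top" for c :: real
    by (rule tendsto_divide_0[OF tendsto_const]) (simp add: filterlim_at_top_imp_at_infinity filterlim_ident)
  have l: "((\<lambda>r. ?v * (1 - real ?d / r) ^ ?d - 1 / r ^ ?d) \<longlongrightarrow> ?v * (1 - 0) ^ ?d - 0) at_top"
  proof (intro tendsto_intros inv)
    show "((\<lambda>r::real. 1 / r ^ ?d) \<longlongrightarrow> 0) at_top"
      by (rule tendsto_divide_0[OF tendsto_const])
         (intro filterlim_at_top_imp_at_infinity filterlim_pow_at_top d0 filterlim_ident)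
  qed
  have u: "((\<lambda>r. ?v * (1 + real ?d / r) ^ ?d) \<longlongrightarrow> ?v * (1 + 0) ^ ?d) at_top"
    by (intro tendsto_intros inv)
  have main: "((\<lambda>r. (real (?N r) - 1) / r ^ ?d) \<longlongrightarrow> ?v) at_top"
  proof (rule tendsto_sandwich[OF _ _ l[simplified] u[simplified]])
    show "\<forall>\<^sub>F r in at_top. ?v * (1 - real ?d / r) ^ ?d - 1 / r ^ ?d \<le> (real (?N r) - 1) / r ^ ?d"
      using eventually_gt_at_top[of "real ?d"]
    proof eventually_elim
      case (elim r)
      then have r: "r > 0" by (metis of_nat_0_le_iff order_le_less_trans)
      have "(1 - real ?d / r) ^ ?d = (max 0 (r - real ?d)) ^ ?d / r ^ ?d"
        using elim r by (simp add: diff_divide_distrib flip: power_divide)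
      then have "?v * (1 - real ?d / r) ^ ?d - 1 / r ^ ?d = (?v * (max 0 (r - real ?d)) ^ ?d - 1) / r ^ ?d"
        by (simp add: diff_divide_distrib)
      also have "\<dots> \<le> (real (?N r) - 1) / r ^ ?d"
        using r lattice_ball_count(1)[of r, where 'd='d] by (intro divide_right_mono) auto
      finally show ?case .
    qed
    show "\<forall>\<^sub>F r in at_top. (real (?N r) - 1) / r ^ ?d \<le> ?v * (1 + real ?d / r) ^ ?d"
      using eventually_gt_at_top[of "0"]
    proof eventually_elim
      case (elim r)
      have "(1 + real ?d / r) ^ ?d = (r + real ?d) ^ ?d / r ^ ?d"
        using elim by (simp add: add_divide_distrib flip: power_divide)
      then have "?v * (1 + real ?d / r) ^ ?d = (?v * (r + real ?d) ^ ?d) / r ^ ?d"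
        by simp
      also have "\<dots> \<ge> (real (?N r) - 1) / r ^ ?d"
        using elim lattice_ball_count(2)[of r, where 'd='d] by (intro divide_right_mono) auto
      finally show ?case .
    qed
  qed
  have "((\<lambda>y. (real (?N (y powr (1/\<alpha>))) - 1) / (y powr (1/\<alpha>)) ^ ?d) \<longlongrightarrow> ?v) at_top"
    by (rule filterlim_compose[OF main]) (use assms in \<open>simp add: filterlim_powr_at_top\<close>)
  moreover have "\<forall>\<^sub>F y in at_top. (real (?N (y powr (1/\<alpha>))) - 1) / (y powr (1/\<alpha>)) ^ ?d
     = lattice_count TYPE('d) \<alpha> y / y powr (real ?d / \<alpha>)"
    using eventually_gt_at_top[of "0"]
  proof eventually_elim
    case (elim y)
    then have "(y powr (1/\<alpha>)) ^ ?d = y powr (real ?d / \<alpha>)"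
      by (simp add: powr_powr flip: powr_realpow)
    then show ?case using lattice_count_eq[of \<alpha> y, where 'd='d] elim assms by simp
  qed
  ultimately show ?thesis by (rule Lim_transform_eventually)
qed

section \<open>Expectations of a function with power growth\<close>

text \<open>Growth of order \<open>y\<^sup>p\<close> is preserved when a function \<open>f\<close> is averaged over random rescalings of its
  argument: on \<open>u \<ge> 0\<close>, the function \<open>u \<mapsto> E[f(u Z)]\<close> again satisfies the hypotheses on \<open>f\<close>. So the
  step can be iterated, once for the exponential variable and once for the weight.\<close>

lemma scaled_expectation_bounds:
  fixes Z :: "'a \<Rightarrow> real" and f :: "real \<Rightarrow> real"
  assumes f: "mono f" "\<And>y. 0 \<le> f y" "\<And>y. y \<ge> 0 \<Longrightarrow> f y \<le> K * y powr p"
    and Z: "Z \<in> borel_measurable M" "\<And>\<omega>. \<omega> \<in> space M \<Longrightarrow> 0 \<le> Z \<omega>" "integrable M (\<lambda>\<omega>. Z \<omega> powr p)"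
  shows "u \<ge> 0 \<Longrightarrow> integrable M (\<lambda>\<omega>. f (u * Z \<omega>))"
    and "u \<ge> 0 \<Longrightarrow> (\<integral>\<omega>. f (u * Z \<omega>) \<partial>M) \<le> K * (\<integral>\<omega>. Z \<omega> powr p \<partial>M) * u powr p"
    and "0 \<le> (\<integral>\<omega>. f (u * Z \<omega>) \<partial>M)"
    and "0 \<le> u \<Longrightarrow> u \<le> v \<Longrightarrow> (\<integral>\<omega>. f (u * Z \<omega>) \<partial>M) \<le> (\<integral>\<omega>. f (v * Z \<omega>) \<partial>M)"
proof -
  have fm [measurable]: "f \<in> borel_measurable borel" using f(1) by (rule borel_measurable_mono)
  note [measurable] = Z(1)
  have dom: "f (u * Z \<omega>) \<le> K * u powr p * Z \<omega> powr p" if "u \<ge> 0" "\<omega> \<in> space M" for u \<omega>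
    using f(3)[of "u * Z \<omega>"] Z(2)[OF that(2)] that by (simp add: powr_mult)
  have intK: "integrable M (\<lambda>\<omega>. K * u powr p * Z \<omega> powr p)" for u
    using Z(3) by simp
  show int: "integrable M (\<lambda>\<omega>. f (u * Z \<omega>))" if "u \<ge> 0" for u
  proof (rule Bochner_Integration.integrable_bound[OF intK[of u]])
    show "AE \<omega> in M. norm (f (u * Z \<omega>)) \<le> norm (K * u powr p * Z \<omega> powr p)"
    proof (rule AE_I2)
      fix \<omega> assume w: "\<omega> \<in> space M"
      have "0 \<le> f (u * Z \<omega>)" by (rule f(2))
      with dom[OF that w] show "norm (f (u * Z \<omega>)) \<le> norm (K * u powr p * Z \<omega> powr p)" by simp
    qed
  qed measurable
  show "(\<integral>\<omega>. f (u * Z \<omega>) \<partial>M) \<le> K * (\<integral>\<omega>. Z \<omega> powr p \<partial>M) * u powr p" if "u \<ge> 0"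
  proof -
    have "(\<integral>\<omega>. f (u * Z \<omega>) \<partial>M) \<le> (\<integral>\<omega>. K * u powr p * Z \<omega> powr p \<partial>M)"
      using that by (intro integral_mono int intK dom)
    then show ?thesis by (simp add: mult_ac)
  qed
  show "0 \<le> (\<integral>\<omega>. f (u * Z \<omega>) \<partial>M)" by (simp add: f(2))
  show "(\<integral>\<omega>. f (u * Z \<omega>) \<partial>M) \<le> (\<integral>\<omega>. f (v * Z \<omega>) \<partial>M)" if "0 \<le> u" "u \<le> v"
    using that by (intro integral_mono int monoD[OF f(1)] mult_right_mono Z(2)) auto
qed

text \<open>For fixed \<open>\<omega>\<close> the quotient \<open>f(u Z) / u\<^sup>p\<close> tends to \<open>v Z\<^sup>p\<close>, and it is dominated by \<open>K Z\<^sup>p\<close>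
  uniformly in \<open>u > 0\<close>.\<close>

lemma scaled_expectation_asymp:
  fixes Z :: "'a \<Rightarrow> real" and f :: "real \<Rightarrow> real"
  assumes f: "mono f" "\<And>y. 0 \<le> f y" "\<And>y. y \<ge> 0 \<Longrightarrow> f y \<le> K * y powr p"
    and lim: "((\<lambda>y. f y / y powr p) \<longlongrightarrow> v) at_top"
    and Z: "Z \<in> borel_measurable M" "\<And>\<omega>. \<omega> \<in> space M \<Longrightarrow> 0 \<le> Z \<omega>" "integrable M (\<lambda>\<omega>. Z \<omega> powr p)"
    and p: "p > 0"
  shows "((\<lambda>u. (\<integral>\<omega>. f (u * Z \<omega>) \<partial>M) / u powr p) \<longlongrightarrow> v * (\<integral>\<omega>. Z \<omega> powr p \<partial>M)) at_top"
proof -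
  have fm [measurable]: "f \<in> borel_measurable borel" using f(1) by (rule borel_measurable_mono)
  note [measurable] = Z(1)
  have f0: "f 0 = 0" using f(2)[of 0] f(3)[of 0] p by simp
  have "((\<lambda>u. \<integral>\<omega>. f (u * Z \<omega>) / u powr p \<partial>M) \<longlongrightarrow> (\<integral>\<omega>. v * Z \<omega> powr p \<partial>M)) at_top"
  proof (rule integral_dominated_convergence_at_top[where w = "\<lambda>\<omega>. K * Z \<omega> powr p"])
    show "integrable M (\<lambda>\<omega>. K * Z \<omega> powr p)" using Z(3) by simp
    show "\<forall>\<^sub>F u in at_top. AE \<omega> in M. norm (f (u * Z \<omega>) / u powr p) \<le> K * Z \<omega> powr p"
      using eventually_gt_at_top[of 0]
    proof eventually_elim
      case (elim u)
      have "norm (f (u * Z \<omega>) / u powr p) \<le> K * Z \<omega> powr p" if "\<omega> \<in> space M" for \<omega>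
        using f(2)[of "u * Z \<omega>"] f(3)[of "u * Z \<omega>"] Z(2)[OF that] elim
        by (simp add: powr_mult divide_le_eq mult_ac)
      then show ?case by (rule AE_I2)
    qed
    show "AE \<omega> in M. ((\<lambda>u. f (u * Z \<omega>) / u powr p) \<longlongrightarrow> v * Z \<omega> powr p) at_top"
    proof (rule AE_I2)
      fix \<omega> assume w: "\<omega> \<in> space M"
      show "((\<lambda>u. f (u * Z \<omega>) / u powr p) \<longlongrightarrow> v * Z \<omega> powr p) at_top"
      proof (cases "Z \<omega> = 0")
        case True then show ?thesis by (simp add: f0)
      next
        case False
        with Z(2)[OF w] have z: "Z \<omega> > 0" by simp
        have "((\<lambda>u. f (u * Z \<omega>) / (u * Z \<omega>) powr p) \<longlongrightarrow> v) at_top"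
          by (rule filterlim_compose[OF lim])
             (use z in \<open>simp add: filterlim_at_top_mult_tendsto_pos[OF tendsto_const _ filterlim_ident]\<close>)
        then have "((\<lambda>u. f (u * Z \<omega>) / (u * Z \<omega>) powr p * Z \<omega> powr p) \<longlongrightarrow> v * Z \<omega> powr p) at_top"
          by (intro tendsto_intros)
        moreover have "\<forall>\<^sub>F u in at_top. f (u * Z \<omega>) / (u * Z \<omega>) powr p * Z \<omega> powr p
            = f (u * Z \<omega>) / u powr p"
          using eventually_gt_at_top[of 0] by eventually_elim (use z in \<open>simp add: powr_mult\<close>)
        ultimately show ?thesis by (rule Lim_transform_eventually)
      qed
    qed
  qed measurable
  then show ?thesis by simp
qed

text \<open>The moment \<open>E[T\<^sup>-\<^sup>p]\<close> of an exponential variable \<open>T\<close> is Euler's integral for \<open>\<Gamma>(1 - p)\<close>; the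
  singularity at 0 is integrable because \<open>p < 1\<close>. The value of \<open>Z\<close> on the null set of nonpositive
  arguments makes it nonnegative everywhere.\<close>

lemma integrable_inverse_exponential:
  assumes "0 < p" "p < 1"
  defines "E \<equiv> density lborel (exponential_density 1)"
    and "Z \<equiv> (\<lambda>e::real. if 0 < e then 1 / e else 0)"
  shows "integrable E (\<lambda>e. Z e powr p)" "(\<integral>e. Z e powr p \<partial>E) = Gamma (1 - p)"
proof -
  have Zm: "Z \<in> borel_measurable borel" unfolding Z_def by measurable
  have eq: "exponential_density 1 e * Z e powr p = indicator {0..} e * (e powr ((1 - p) - 1) / exp e)" for e
    using assms by (auto simp: exponential_density_def Z_def indicator_def powr_divide powr_minus exp_minus field_simps)
  have hb: "has_bochner_integral lborel (\<lambda>e. exponential_density 1 e * Z e powr p) (Gamma (1 - p))"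
  proof (rule has_bochner_integral_nn_integral)
    have "(\<integral>\<^sup>+ e. ennreal (indicator {0..} e * (e powr ((1-p) - 1) / exp e)) \<partial>lborel) = ennreal (Gamma (1-p))"
      using assms by (intro nn_integral_has_integral_lebesgue Gamma_integral_real) auto
    then show "(\<integral>\<^sup>+ e. ennreal (exponential_density 1 e * Z e powr p) \<partial>lborel) = ennreal (Gamma (1 - p))"
      unfolding eq .
  qed (use assms Zm in \<open>auto simp: exponential_density_nonneg Gamma_real_nonneg\<close>)
  have m: "(\<lambda>e. Z e powr p) \<in> borel_measurable lborel" using Zm by measurable
  show "integrable E (\<lambda>e. Z e powr p)"
    unfolding E_def using hb m
    by (subst integrable_density) (auto simp: exponential_density_nonneg has_bochner_integral_iff)
  show "(\<integral>e. Z e powr p \<partial>E) = Gamma (1 - p)"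
    unfolding E_def using hb m
    by (subst integral_density) (auto simp: exponential_density_nonneg has_bochner_integral_iff)
qed

text \<open>The event is \<open>T < u / c\<close> for an exponential variable \<open>T\<close>. This turns edge probabilities into
  probabilities that a lattice point is counted at a random level.\<close>

lemma exponential_threshold:
  assumes "0 \<le> u" "0 < c"
  defines "E \<equiv> density lborel (exponential_density 1)"
    and "Z \<equiv> (\<lambda>e::real. if 0 < e then 1 / e else 0)"
  shows "(\<integral>e. indicator {e. c < u * Z e} e \<partial>E) = 1 - exp (- u / c)"
proof -
  interpret E: prob_space E unfolding E_def by (rule prob_space_exponential_density) simp
  have D: "distributed E lborel (\<lambda>x. x) (exponential_density 1)"
    unfolding distributed_def E_def by (auto simp: distr_id2)
  have eq: "{e. c < u * Z e} = {0<..<u / c}"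
    using assms by (auto simp: Z_def field_simps mult_less_0_iff split: if_splits)
  have nul: "AE e in E. e \<noteq> 0 \<and> e \<noteq> u / c"
    unfolding E_def using AE_lborel_singleton[of "0::real"] AE_lborel_singleton[of "u / c"]
    by (subst AE_density) auto
  have pos: "AE e in E. 0 \<le> e"
    unfolding E_def by (subst AE_density) (auto simp: exponential_density_def)
  have "(\<integral>e. indicator {e. c < u * Z e} e \<partial>E) = E.prob {0<..<u / c}"
    unfolding eq by (simp add: E_def)
  also have "\<dots> = E.prob {e \<in> space E. e \<le> u / c}"
  proof (rule E.finite_measure_eq_AE)
    show "AE x in E. (x \<in> {0<..<u / c}) = (x \<in> {e \<in> space E. e \<le> u / c})"
      using nul pos by eventually_elim (auto simp: E_def)
  qed (auto simp: E_def)
  also have "\<dots> = 1 - exp (- (u / c) * 1)"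
    using assms by (intro E.exponential_distributedD_le[OF D]) auto
  finally show ?thesis by simp
qed

section \<open>Regularly varying tails\<close>

text \<open>Since \<open>H(2s) / H(s)\<close> stays above some \<open>2\<^sup>-\<^sup>k\<close> from a point \<open>s0\<close> on, passing from \<open>s\<close> to \<open>2s\<close> does
  not decrease \<open>H(s) s\<^sup>k\<close>. A lower bound on one dyadic interval therefore propagates, and \<open>H\<close> is at least a multiple
  of \<open>s\<^sup>-\<^sup>k\<close>.\<close>

lemma exp_decay_regular_tail:
  fixes H :: "real \<Rightarrow> real"
  assumes anti: "\<And>x y. 0 < x \<Longrightarrow> x \<le> y \<Longrightarrow> H y \<le> H x"
    and pos: "\<forall>\<^sub>F s in at_top. 0 < H s"
    and lim: "((\<lambda>s. H (2 * s) / H s) \<longlongrightarrow> \<kappa>) at_top" "0 < \<kappa>"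
    and c: "0 < c"
  shows "((\<lambda>s. exp (- c * s) / H s) \<longlongrightarrow> 0) at_top"
proof -
  obtain k :: nat where k: "(1/2) ^ k < \<kappa>"
    using real_arch_pow_inv[of \<kappa> "1/2"] lim(2) by auto
  have "\<forall>\<^sub>F s in at_top. (1/2) ^ k < H (2 * s) / H s \<and> 0 < H s \<and> 0 < s"
    using order_tendstoD(1)[OF lim(1) k] pos eventually_gt_at_top[of 0] by eventually_elim auto
  then obtain s0 where s0: "\<And>s. s \<ge> s0 \<Longrightarrow> (1/2) ^ k < H (2 * s) / H s \<and> 0 < H s \<and> 0 < s"
    by (auto simp: eventually_at_top_linorder)
  have s0pos: "s0 > 0" and H0: "H s > 0" if "s \<ge> s0" for s using s0 that by blast+
  define b where "b = H (2 * s0) * s0 ^ k"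
  have b: "b > 0" using s0[of s0] H0[of "2 * s0"] by (simp add: b_def)
  have low: "\<forall>s. s0 * 2 ^ n \<le> s \<and> s \<le> s0 * 2 ^ Suc n \<longrightarrow> b \<le> H s * s ^ k" for n
  proof (induction n)
    case 0
    show ?case
    proof safe
      fix s assume s: "s0 * 2 ^ 0 \<le> s" "s \<le> s0 * 2 ^ Suc 0"
      have "H (2 * s0) \<le> H s" using s s0[of s0] by (intro anti) auto
      then show "b \<le> H s * s ^ k" unfolding b_def
        using s s0[of s0] H0[of "2 * s0"] by (intro mult_mono power_mono) auto
    qed
  next
    case (Suc n)
    show ?case
    proof safe
      fix s assume s: "s0 * 2 ^ Suc n \<le> s" "s \<le> s0 * 2 ^ Suc (Suc n)"
      define r where "r = s / 2"
      have r: "s0 * 2 ^ n \<le> r" "r \<le> s0 * 2 ^ Suc n" using s by (auto simp: r_def)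
      have "s0 * 1 \<le> s0 * 2 ^ n" using s0[of s0] by (intro mult_left_mono) auto
      with r have rs: "r \<ge> s0" by linarith
      have "b \<le> H r * r ^ k" using Suc r by blast
      also have "\<dots> = ((1/2) ^ k * H r) * (2 * r) ^ k"
        by (simp add: power_mult_distrib power_one_over)
      also have "\<dots> \<le> H (2 * r) * (2 * r) ^ k"
        using s0[OF rs] by (intro mult_right_mono) (auto simp: field_simps)
      finally show "b \<le> H s * s ^ k" by (simp add: r_def)
    qed
  qed
  have lowb: "b \<le> H s * s ^ k" if "s \<ge> s0" for s
  proof -
    define n where "n = nat \<lfloor>log 2 (s / s0)\<rfloor>"
    have ge: "s / s0 \<ge> 1" using that s0[of s0] by simp
    then have l0: "log 2 (s / s0) \<ge> 0" by (simp add: zero_le_log_cancel_iff)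
    then have "real n \<le> log 2 (s / s0)" "log 2 (s / s0) \<le> real (Suc n)"
      unfolding n_def by linarith+
    then have "2 powr real n \<le> s / s0" "s / s0 \<le> 2 powr real (Suc n)"
      using ge by (simp_all add: le_log_iff log_le_iff)
    then have "2 ^ n \<le> s / s0" "s / s0 \<le> 2 ^ Suc n"
      by (simp_all only: powr_realpow zero_less_numeral)
    then have "s0 * 2 ^ n \<le> s" "s \<le> s0 * 2 ^ Suc n"
      using s0[of s0] by (simp_all add: field_simps)
    with low show ?thesis by blast
  qed
  have up: "((\<lambda>s. (c * s) ^ k / exp (c * s) * (1 / (b * c ^ k))) \<longlongrightarrow> 0 * (1 / (b * c ^ k))) at_top"
    by (intro tendsto_mult tendsto_const filterlim_compose[OF tendsto_power_div_exp_0]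
         filterlim_tendsto_pos_mult_at_top[OF tendsto_const c filterlim_ident])
  show ?thesis
  proof (rule tendsto_sandwich[OF _ _ tendsto_const up[simplified]])
    show "\<forall>\<^sub>F s in at_top. 0 \<le> exp (- c * s) / H s"
      using pos by eventually_elim simp
    show "\<forall>\<^sub>F s in at_top. exp (- c * s) / H s \<le> (c * s) ^ k / (exp (c * s) * (b * c ^ k))"
      using eventually_ge_at_top[of s0]
    proof eventually_elim
      case (elim s)
      have "b * c ^ k \<le> (c * s) ^ k * H s"
        using mult_right_mono[OF lowb[OF elim], of "c ^ k"] c by (simp add: power_mult_distrib mult_ac)
      then show ?case using b c H0[OF elim]
        by (simp add: exp_minus field_simps)
    qed
  qed
qed

text \<open>The probabilistic input is reduced to the two inequalities \<open>upper\<close> and \<open>lower\<close>. With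
  \<open>\<theta>(s) = (s / C)\<^bsup>1/p\<^esup>\<close>, the asymptotic inverse of \<open>m\<close>, they give \<open>P(s) \<sim> h(\<theta>(s))\<close> by a choice of
  \<open>w = \<theta>((1 - \<epsilon>) s)\<close> and \<open>w = \<theta>((1 + \<epsilon>) s)\<close>: both \<open>h(w) / h(\<theta>(s))\<close> tend to constants that are
  close to 1 for small \<open>\<epsilon>\<close>.\<close>

lemma regular_tail_transfer:
  fixes h m P :: "real \<Rightarrow> real"
  assumes p: "p > 0" and C: "C > 0"
    and anti: "\<And>x y. 0 < x \<Longrightarrow> x \<le> y \<Longrightarrow> h y \<le> h x"
    and pos: "\<forall>\<^sub>F w in at_top. 0 < h w"
    and rv: "\<And>b. 0 < b \<Longrightarrow> ((\<lambda>w. h (b * w) / h w) \<longlongrightarrow> b powr (- \<beta>)) at_top"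
    and m: "((\<lambda>w. m w / w powr p) \<longlongrightarrow> C) at_top"
    and upper: "\<And>s w t. 0 < s \<Longrightarrow> 0 < w \<Longrightarrow> 0 < t \<Longrightarrow> P s \<le> h w + exp ((exp t - 1) * m w - t * s)"
    and lower: "\<And>s w t. 0 < s \<Longrightarrow> 0 < w \<Longrightarrow> 0 < t \<Longrightarrow>
        h w * (1 - exp (t * s - (1 - exp (- t)) * m w)) \<le> P s"
  shows "\<exists>l. slowly_varying l \<and> (\<forall>s>0. P s = s powr (- (\<beta> / p)) * l s)"
proof -
  define \<theta> where "\<theta> s = (s / C) powr (1 / p)" for s
  define H where "H s = h (\<theta> s)" for s
  have \<theta>pos: "\<theta> s > 0" if "s > 0" for s using that C by (simp add: \<theta>_def)
  have \<theta>mult: "\<theta> (b * s) = b powr (1 / p) * \<theta> s" if "b > 0" "s > 0" for b s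
    using that C powr_mult[of b "s / C" "1 / p"] by (simp add: \<theta>_def)
  have \<theta>p: "\<theta> s powr p = s / C" if "s > 0" for s
    using that C p by (simp add: \<theta>_def powr_powr)
  have \<theta>top: "filterlim \<theta> at_top at_top"
  proof -
    have "filterlim (\<lambda>s. 1 / C * s) at_top at_top"
      using C by (intro filterlim_tendsto_pos_mult_at_top[OF tendsto_const _ filterlim_ident]) simp
    then show ?thesis unfolding \<theta>_def
      by (intro filterlim_compose[OF filterlim_powr_at_top]) (use p in simp_all)
  qed
  have Hpos: "\<forall>\<^sub>F s in at_top. 0 < H s"
    unfolding H_def using \<theta>top pos by (rule eventually_compose_filterlim[rotated])
  have Hanti: "H y \<le> H x" if "0 < x" "x \<le> y" for x y
    unfolding H_def using that C p by (intro anti \<theta>pos) (auto simp: \<theta>_def intro!: powr_mono2 divide_right_mono)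
  have Hrv: "((\<lambda>s. H (b * s) / H s) \<longlongrightarrow> b powr (- (\<beta> / p))) at_top" if b: "b > 0" for b
  proof -
    have "((\<lambda>s. h (b powr (1 / p) * \<theta> s) / h (\<theta> s)) \<longlongrightarrow> (b powr (1 / p)) powr (- \<beta>)) at_top"
      using b by (intro filterlim_compose[OF rv \<theta>top]) simp
    moreover have "\<forall>\<^sub>F s in at_top. h (b powr (1 / p) * \<theta> s) / h (\<theta> s) = H (b * s) / H s"
      using eventually_gt_at_top[of 0] by eventually_elim (use b in \<open>simp add: H_def \<theta>mult\<close>)
    ultimately have "((\<lambda>s. H (b * s) / H s) \<longlongrightarrow> (b powr (1 / p)) powr (- \<beta>)) at_top"
      by (rule Lim_transform_eventually)
    then show ?thesis by (simp add: powr_powr)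
  qed
  have scale: "filterlim (\<lambda>s. b * s) at_top at_top" if "b > 0" for b :: real
    using that by (intro filterlim_tendsto_pos_mult_at_top[OF tendsto_const _ filterlim_ident])
  have mlim: "((\<lambda>s. m (\<theta> (b * s)) / s) \<longlongrightarrow> b) at_top" if b: "b > 0" for b
  proof -
    have "((\<lambda>s. b / C * (m (\<theta> (b * s)) / \<theta> (b * s) powr p)) \<longlongrightarrow> b / C * C) at_top"
      by (intro tendsto_mult tendsto_const filterlim_compose[OF m] filterlim_compose[OF \<theta>top] scale b)
    moreover have "\<forall>\<^sub>F s in at_top. b / C * (m (\<theta> (b * s)) / \<theta> (b * s) powr p) = m (\<theta> (b * s)) / s"
      using eventually_gt_at_top[of 0] by eventually_elim (use b C in \<open>simp add: \<theta>p field_simps\<close>)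
    ultimately have "((\<lambda>s. m (\<theta> (b * s)) / s) \<longlongrightarrow> b / C * C) at_top"
      by (rule Lim_transform_eventually)
    then show ?thesis using C by simp
  qed
  have decay: "((\<lambda>s. exp (- c * s) / H s) \<longlongrightarrow> 0) at_top" if "c > 0" for c
    by (rule exp_decay_regular_tail[OF Hanti Hpos Hrv _ that]) auto
  have up: "((\<lambda>s. H ((1 - \<epsilon>) * s) / H s + exp (- ((\<epsilon> / 2) ^ 3) * s) / H s) \<longlongrightarrow> (1 - \<epsilon>) powr (- (\<beta> / p))) at_top"
    and upP: "\<forall>\<^sub>F s in at_top. P s / H s \<le> H ((1 - \<epsilon>) * s) / H s + exp (- ((\<epsilon> / 2) ^ 3) * s) / H s"
    if \<epsilon>: "0 < \<epsilon>" "\<epsilon> < 1" for \<epsilon>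
  proof -
    show "((\<lambda>s. H ((1 - \<epsilon>) * s) / H s + exp (- ((\<epsilon> / 2) ^ 3) * s) / H s) \<longlongrightarrow> (1 - \<epsilon>) powr (- (\<beta> / p))) at_top"
      using tendsto_add[OF Hrv[of "1 - \<epsilon>"] decay[of "(\<epsilon> / 2) ^ 3"]] \<epsilon> by simp
    have "\<forall>\<^sub>F s in at_top. m (\<theta> ((1 - \<epsilon>) * s)) / s < 1 - \<epsilon> / 2"
      using \<epsilon> by (intro order_tendstoD(2)[OF mlim]) auto
    then show "\<forall>\<^sub>F s in at_top. P s / H s \<le> H ((1 - \<epsilon>) * s) / H s + exp (- ((\<epsilon> / 2) ^ 3) * s) / H s"
      using Hpos eventually_gt_at_top[of 0]
    proof eventually_elim
      case (elim s)
      let ?m = "m (\<theta> ((1 - \<epsilon>) * s))"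
      define t where "t = \<epsilon> / 2"
      have t: "0 < t" "t < 1" using \<epsilon> by (auto simp: t_def)
      \<comment> \<open>With \<open>m \<le> (1 - t) s\<close> and \<open>e\<^sup>t - 1 \<le> t + t\<^sup>2\<close>, the exponent \<open>(t + t\<^sup>2) (1 - t) s - t s\<close> is
        exactly \<open>-t\<^sup>3 s\<close>.\<close>
      have "exp t - 1 \<le> t + t\<^sup>2" using exp_bound[of t] t by simp
      moreover have "?m \<le> (1 - t) * s" using elim by (simp add: t_def field_simps)
      ultimately have "(exp t - 1) * ?m \<le> (exp t - 1) * ((1 - t) * s)"
        using t by (intro mult_left_mono) auto
      also have "\<dots> \<le> (t + t\<^sup>2) * ((1 - t) * s)"
        using \<open>exp t - 1 \<le> t + t\<^sup>2\<close> t elim by (intro mult_right_mono) auto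
      finally have "(exp t - 1) * ?m - t * s \<le> - (t ^ 3) * s"
        by (simp add: algebra_simps power2_eq_square power3_eq_cube)
      then have "exp ((exp t - 1) * ?m - t * s) \<le> exp (- (t ^ 3) * s)" by simp
      moreover have "P s \<le> H ((1 - \<epsilon>) * s) + exp ((exp t - 1) * ?m - t * s)"
        unfolding H_def using elim t \<epsilon> by (intro upper \<theta>pos) auto
      ultimately have "P s \<le> H ((1 - \<epsilon>) * s) + exp (- (t ^ 3) * s)" by linarith
      then show ?case using elim unfolding t_def add_divide_distrib[symmetric]
        by (intro divide_right_mono) auto
    qed
  qed
  have lo: "((\<lambda>s. H ((1 + \<epsilon>) * s) / H s * (1 - exp (- ((\<epsilon> / 4)\<^sup>2 / (1 + \<epsilon> / 4)) * s))) \<longlongrightarrow> (1 + \<epsilon>) powr (- (\<beta> / p))) at_top"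
    and loP: "\<forall>\<^sub>F s in at_top. H ((1 + \<epsilon>) * s) / H s * (1 - exp (- ((\<epsilon> / 4)\<^sup>2 / (1 + \<epsilon> / 4)) * s)) \<le> P s / H s"
    if \<epsilon>: "0 < \<epsilon>" for \<epsilon>
  proof -
    have scale1: "filterlim (\<lambda>s. (1 + \<epsilon>) * s) at_top at_top" using \<epsilon> by (intro scale) simp
    have c: "(\<epsilon> / 4)\<^sup>2 / (1 + \<epsilon> / 4) > 0" using \<epsilon> by simp
    have "((\<lambda>s. exp (- ((\<epsilon> / 4)\<^sup>2 / (1 + \<epsilon> / 4) * s))) \<longlongrightarrow> 0) at_top"
      by (intro filterlim_compose[OF exp_at_bot] filterlim_uminus_at_bot_at_top
           filterlim_compose[OF filterlim_uminus_at_bot_at_top scale[OF c]])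
    then have "((\<lambda>s. exp (- ((\<epsilon> / 4)\<^sup>2 / (1 + \<epsilon> / 4)) * s)) \<longlongrightarrow> 0) at_top"
      by simp
    from tendsto_mult[OF Hrv[of "1 + \<epsilon>"] tendsto_diff[OF tendsto_const[of 1] this]] \<epsilon>
    show "((\<lambda>s. H ((1 + \<epsilon>) * s) / H s * (1 - exp (- ((\<epsilon> / 4)\<^sup>2 / (1 + \<epsilon> / 4)) * s))) \<longlongrightarrow> (1 + \<epsilon>) powr (- (\<beta> / p))) at_top"
      by simp
    have "\<forall>\<^sub>F s in at_top. 1 + \<epsilon> / 2 < m (\<theta> ((1 + \<epsilon>) * s)) / s"
      using \<epsilon> by (intro order_tendstoD(1)[OF mlim]) auto
    then show "\<forall>\<^sub>F s in at_top. H ((1 + \<epsilon>) * s) / H s * (1 - exp (- ((\<epsilon> / 4)\<^sup>2 / (1 + \<epsilon> / 4)) * s)) \<le> P s / H s"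
      using Hpos eventually_gt_at_top[of 0] eventually_compose_filterlim[OF Hpos scale1]
    proof eventually_elim
      case (elim s)
      have Hs: "H ((1 + \<epsilon>) * s) > 0" using elim \<epsilon> by simp
      let ?m = "m (\<theta> ((1 + \<epsilon>) * s))"
      define t where "t = \<epsilon> / 4"
      have t: "0 < t" using \<epsilon> by (auto simp: t_def)
      \<comment> \<open>Here \<open>m \<ge> (1 + 2t) s\<close>: the factor 2 beats the loss in \<open>1 - e\<^sup>-\<^sup>t \<ge> t / (1 + t)\<close>, and this is
        why \<open>t\<close> is \<open>\<epsilon> / 4\<close> and not \<open>\<epsilon> / 2\<close>.\<close>
      have "1 + t \<le> exp t" by (rule exp_ge_add_one_self)
      then have "exp (- t) \<le> 1 / (1 + t)" using t by (simp add: exp_minus field_simps)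
      moreover have "1 - 1 / (1 + t) = t / (1 + t)" using t by (simp add: field_simps)
      ultimately have et: "t / (1 + t) \<le> 1 - exp (- t)" by linarith
      have "t * s - (1 - exp (- t)) * ?m \<le> t * s - t / (1 + t) * ((1 + 2 * t) * s)"
      proof -
        have "(1 + 2 * t) * s \<le> ?m" using elim by (simp add: t_def field_simps)
        then show ?thesis using et t elim by (intro diff_left_mono mult_mono) auto
      qed
      also have "\<dots> = - (t\<^sup>2 / (1 + t)) * s"
        using t by (simp add: field_simps power2_eq_square)
      finally have "exp (t * s - (1 - exp (- t)) * ?m) \<le> exp (- (t\<^sup>2 / (1 + t)) * s)" by simp
      then have "H ((1 + \<epsilon>) * s) * (1 - exp (- (t\<^sup>2 / (1 + t)) * s))
          \<le> H ((1 + \<epsilon>) * s) * (1 - exp (t * s - (1 - exp (- t)) * ?m))"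
        using Hs by (intro mult_left_mono) auto
      also have "\<dots> \<le> P s"
        unfolding H_def using elim t \<epsilon> by (intro lower \<theta>pos) auto
      finally have "H ((1 + \<epsilon>) * s) * (1 - exp (- (t\<^sup>2 / (1 + t)) * s)) / H s \<le> P s / H s"
        using elim by (intro divide_right_mono) auto
      then show ?case by (simp add: t_def)
    qed
  qed
  have PH: "((\<lambda>s. P s / H s) \<longlongrightarrow> 1) at_top"
  proof (rule order_tendstoI)
    fix a :: real assume a: "a < 1"
    have "((\<lambda>\<epsilon>. (1 + \<epsilon>) powr (- (\<beta> / p))) \<longlongrightarrow> (1 + 0) powr (- (\<beta> / p))) (at_right 0)"
      by (intro tendsto_intros) auto
    then have "\<forall>\<^sub>F \<epsilon> in at_right 0. a < (1 + \<epsilon>) powr (- (\<beta> / p))"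
      using a by (intro order_tendstoD(1)) auto
    with eventually_at_right_less[of "0::real"]
    have "\<forall>\<^sub>F \<epsilon> in at_right 0. 0 < \<epsilon> \<and> a < (1 + \<epsilon>) powr (- (\<beta> / p))"
      by eventually_elim auto
    then obtain \<epsilon> where \<epsilon>: "0 < \<epsilon>" "a < (1 + \<epsilon>) powr (- (\<beta> / p))"
      by (metis (mono_tags, lifting) eventually_happens' trivial_limit_at_right_real)
    show "\<forall>\<^sub>F s in at_top. a < P s / H s"
      using order_tendstoD(1)[OF lo[OF \<epsilon>(1)] \<epsilon>(2)] loP[OF \<epsilon>(1)] by eventually_elim auto
  next
    fix a :: real assume a: "1 < a"
    have "((\<lambda>\<epsilon>. (1 - \<epsilon>) powr (- (\<beta> / p))) \<longlongrightarrow> (1 - 0) powr (- (\<beta> / p))) (at_right 0)"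
      by (intro tendsto_intros) auto
    then have "\<forall>\<^sub>F \<epsilon> in at_right 0. (1 - \<epsilon>) powr (- (\<beta> / p)) < a"
      using a by (intro order_tendstoD(2)) auto
    with eventually_at_right_real[OF zero_less_one[where 'a=real]]
    have "\<forall>\<^sub>F \<epsilon> in at_right 0. \<epsilon> \<in> {0<..<1} \<and> (1 - \<epsilon>) powr (- (\<beta> / p)) < a"
      by eventually_elim auto
    then obtain \<epsilon> where \<epsilon>: "0 < \<epsilon>" "\<epsilon> < 1" "(1 - \<epsilon>) powr (- (\<beta> / p)) < a"
      by (metis (mono_tags, lifting) eventually_happens' trivial_limit_at_right_real greaterThanLessThan_iff)
    show "\<forall>\<^sub>F s in at_top. P s / H s < a"
      using order_tendstoD(2)[OF up[OF \<epsilon>(1,2)] \<epsilon>(3)] upP[OF \<epsilon>(1,2)] by eventually_elim auto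
  qed
  have Ppos: "\<forall>\<^sub>F s in at_top. 0 < P s"
    using order_tendstoD(1)[OF PH zero_less_one] Hpos
    by eventually_elim (simp add: zero_less_divide_iff)
  define l where "l s = s powr (\<beta> / p) * P s" for s
  have "slowly_varying l"
    unfolding slowly_varying_def
  proof (intro conjI allI impI)
    show "\<forall>\<^sub>F s in at_top. 0 < l s"
      using Ppos eventually_gt_at_top[of 0] by eventually_elim (simp add: l_def)
    fix a :: real assume a: "a > 0"
    have "((\<lambda>s. a powr (\<beta> / p) * ((P (a * s) / H (a * s)) * (H (a * s) / H s) / (P s / H s)))
        \<longlongrightarrow> a powr (\<beta> / p) * (1 * a powr (- (\<beta> / p)) / 1)) at_top"
      by (intro tendsto_intros filterlim_compose[OF PH scale] Hrv a PH) simp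
    moreover have "\<forall>\<^sub>F s in at_top. a powr (\<beta> / p) * ((P (a * s) / H (a * s)) * (H (a * s) / H s) / (P s / H s))
        = l (a * s) / l s"
      using Hpos eventually_compose_filterlim[OF Hpos scale[OF a]] Ppos eventually_gt_at_top[of 0]
      by eventually_elim (use a in \<open>simp add: l_def powr_mult\<close>)
    ultimately have "((\<lambda>s. l (a * s) / l s) \<longlongrightarrow> a powr (\<beta> / p) * (1 * a powr (- (\<beta> / p)) / 1)) at_top"
      by (rule Lim_transform_eventually)
    then show "((\<lambda>s. l (a * s) / l s) \<longlongrightarrow> 1) at_top"
      using a by (simp flip: powr_add)
  qed
  moreover have "P s = s powr (- (\<beta> / p)) * l s" if "s > 0" for s
    using that unfolding l_def mult.assoc[symmetric] by (simp flip: powr_add)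
  ultimately show ?thesis by blast
qed

text \<open>On \<open>2\<^sup>n < Z \<le> 2\<^bsup>n+1\<^esup>\<close> the power \<open>Z\<^sup>p\<close> is at most \<open>2\<^sup>p 2\<^bsup>np\<^esup>\<close>. The resulting dyadic series
  \<open>\<Sum>\<^sub>n 2\<^bsup>np\<^esup> P(Z > 2\<^sup>n)\<close> converges by the ratio test, because its quotients tend to
  \<open>2\<^bsup>p - \<beta>\<^esup> < 1\<close>.\<close>

lemma integrable_powr_of_regular_tail:
  fixes Z :: "'a \<Rightarrow> real"
  assumes M: "prob_space M" and Z: "Z \<in> borel_measurable M" "\<And>\<omega>. \<omega> \<in> space M \<Longrightarrow> 0 \<le> Z \<omega>"
    and h: "\<And>w. h w = measure M {\<omega> \<in> space M. Z \<omega> > w}"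
    and pos: "\<forall>\<^sub>F w in at_top. 0 < h w"
    and lim: "((\<lambda>w. h (2 * w) / h w) \<longlongrightarrow> 2 powr (- \<beta>)) at_top"
    and p: "0 < p" "p < \<beta>"
  shows "integrable M (\<lambda>\<omega>. Z \<omega> powr p)"
proof -
  interpret prob_space M by fact
  note [measurable] = Z(1)
  define a where "a n = 2 powr p * (2 powr p) ^ n * h (2 ^ n)" for n :: nat
  have "filterlim (\<lambda>n. (2::real) ^ n) at_top sequentially"
    by (rule filterlim_at_top_mono[OF filterlim_real_sequentially])
       (intro always_eventually allI less_imp_le of_nat_less_two_power)
  note two = this
  have "(\<lambda>n. 2 powr p * (h (2 * 2 ^ n) / h (2 ^ n))) \<longlonglongrightarrow> 2 powr p * 2 powr (- \<beta>)"
    by (intro tendsto_intros filterlim_compose[OF lim two])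
  moreover have "2 powr p * 2 powr (- \<beta>) < (1::real)"
    using p powr_less_mono[of "p - \<beta>" 0 "2::real"] by (simp flip: powr_add)
  then obtain q where q: "2 powr p * 2 powr (- \<beta>) < q" "q < (1::real)" using dense by blast
  ultimately have "\<forall>\<^sub>F n in sequentially. 2 powr p * (h (2 * 2 ^ n) / h (2 ^ n)) < q"
    by (intro order_tendstoD(2))
  moreover have "\<forall>\<^sub>F n in sequentially. 0 < h (2 ^ n)"
    by (rule eventually_compose_filterlim[OF pos two])
  ultimately have "\<forall>\<^sub>F n in sequentially. norm (a (Suc n)) \<le> q * norm (a n)"
  proof eventually_elim
    case (elim n)
    then have "2 powr p * h (2 * 2 ^ n) \<le> q * h (2 ^ n)" by (simp add: field_simps)
    then have "2 powr p * (2 powr p) ^ n * (2 powr p * h (2 * 2 ^ n)) \<le> 2 powr p * (2 powr p) ^ n * (q * h (2 ^ n))"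
      by (intro mult_left_mono) auto
    then show ?case by (simp add: a_def h mult_ac)
  qed
  then obtain N where "\<And>n. n \<ge> N \<Longrightarrow> norm (a (Suc n)) \<le> q * norm (a n)"
    by (auto simp: eventually_sequentially)
  then have suma: "summable a" by (intro summable_ratio_test[OF q(2)])
  define g where "g n \<omega> = 2 powr p * (2 powr p) ^ n * indicator {\<omega> \<in> space M. Z \<omega> > 2 ^ n} \<omega>" for n :: nat and \<omega>
  have gpos: "0 \<le> g n \<omega>" for n \<omega> by (simp add: g_def)
  have "integrable M (indicator A :: 'a \<Rightarrow> real)" if "A \<in> sets M" for A
    using that by (intro integrable_const_bound[where B = 1]) (auto split: split_indicator)
  then have gint: "integrable M (g n)" for n unfolding g_def by (intro integrable_mult_right) simp
  have ga: "(\<integral>\<omega>. g n \<omega> \<partial>M) = a n" for n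
    unfolding g_def a_def h by (simp add: Int_absorb2 Collect_restrict)
  have gsum: "summable (\<lambda>n. g n \<omega>)" for \<omega>
  proof -
    obtain n0 :: nat where n0: "Z \<omega> < 2 ^ n0" using real_arch_pow[of 2 "Z \<omega>"] by auto
    show ?thesis
    proof (rule summable_finite[of "{..<n0}"])
      show "g n \<omega> = 0" if "n \<notin> {..<n0}" for n
      proof -
        have "(2::real) ^ n0 \<le> 2 ^ n" using that by (intro power_increasing) auto
        with n0 have "\<not> Z \<omega> > 2 ^ n" by linarith
        then show ?thesis by (simp add: g_def)
      qed
    qed simp
  qed
  have int: "integrable M (\<lambda>\<omega>. \<Sum>n. g n \<omega>)"
    using gint gsum gpos suma by (intro integrable_suminf) (auto simp: ga)
  have bound: "Z \<omega> powr p \<le> 1 + (\<Sum>n. g n \<omega>)" if w: "\<omega> \<in> space M" for \<omega>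
  proof (cases "Z \<omega> \<le> 1")
    case True
    then have "Z \<omega> powr p \<le> 1 powr p" using Z(2)[OF w] p by (intro powr_mono2) auto
    then show ?thesis using suminf_nonneg[OF gsum gpos, of \<omega>] by simp
  next
    case False
    define L where "L = log 2 (Z \<omega>)"
    define n where "n = nat (\<lceil>L\<rceil> - 1)"
    have "L > 0" using False by (simp add: L_def)
    then have n: "real n < L" "L \<le> real (Suc n)" unfolding n_def by linarith+
    have ZL: "Z \<omega> = 2 powr L" using False by (simp add: L_def)
    have "2 powr real n < Z \<omega>" "Z \<omega> \<le> 2 powr real (Suc n)" unfolding ZL using n by auto
    then have lo: "2 ^ n < Z \<omega>" and hi: "Z \<omega> \<le> 2 powr real (Suc n)" by (simp_all add: powr_realpow)
    have "Z \<omega> powr p \<le> (2 powr real (Suc n)) powr p"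
      using hi Z(2)[OF w] p by (intro powr_mono2) auto
    also have "\<dots> = (2 powr p) powr real (Suc n)" by (simp add: powr_powr mult.commute)
    also have "\<dots> = g n \<omega>" using lo w by (subst powr_realpow) (auto simp: g_def)
    also have "\<dots> \<le> (\<Sum>n. g n \<omega>)"
      using sum_le_suminf[OF gsum, of "{n}" \<omega>] gpos by simp
    finally show ?thesis by simp
  qed
  show ?thesis
  proof (rule Bochner_Integration.integrable_bound)
    show "integrable M (\<lambda>\<omega>. 1 + (\<Sum>n. g n \<omega>))" using int by simp
    show "AE \<omega> in M. norm (Z \<omega> powr p) \<le> norm (1 + (\<Sum>n. g n \<omega>))"
    proof (rule AE_I2)
      fix \<omega> assume "\<omega> \<in> space M"
      from bound[OF this] have "Z \<omega> powr p \<le> \<bar>1 + (\<Sum>n. g n \<omega>)\<bar>" by linarith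
      then show "norm (Z \<omega> powr p) \<le> norm (1 + (\<Sum>n. g n \<omega>))" by simp
    qed
  qed measurable
qed


section \<open>Growth of the conditional mean degree\<close>

text \<open>This is the series \<open>\<Sum>\<^sub>x (1 - exp (-u / |x|\<^sup>\<alpha>))\<close> over \<open>x \<noteq> 0\<close>, written as \<open>E[N(u / T)]\<close> with
  \<open>T\<close> exponential; lemma \<open>lattice_sum_series\<close> justifies the name. The cut-off at 0 makes it monotone
  on the whole real line.\<close>

definition lattice_sum :: "('d::finite) itself \<Rightarrow> real \<Rightarrow> real \<Rightarrow> real" where
  "lattice_sum T \<alpha> u = (\<integral>e. lattice_count T \<alpha> (max 0 u * (if 0 < e then 1 / e else 0))
      \<partial>density lborel (exponential_density 1))"

definition lattice_box :: "nat \<Rightarrow> (int ^ 'd::finite) set" where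
  "lattice_box n = {x. x \<noteq> 0 \<and> lattice_dist 0 x < real n}"

lemma finite_lattice_box: "finite (lattice_box n :: (int ^ 'd::finite) set)"
  unfolding lattice_box_def by (rule finite_subset[OF _ finite_bounded_lattice[of "real n"]]) auto

lemma lattice_box_exhausts:
  assumes "finite B" "0 \<notin> (B :: (int ^ 'd::finite) set)"
  shows "\<forall>\<^sub>F n in sequentially. B \<subseteq> lattice_box n"
proof -
  have "\<forall>\<^sub>F n in sequentially. x \<in> lattice_box n" if "x \<in> B" for x
    using filterlim_at_top_dense[THEN iffD1, OF filterlim_real_sequentially, rule_format, of "lattice_dist 0 x"]
    by eventually_elim (use that assms in \<open>auto simp: lattice_box_def\<close>)
  then have "\<forall>\<^sub>F n in sequentially. \<forall>x\<in>B. x \<in> lattice_box n"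
    using assms(1) by (simp add: eventually_ball_finite_distrib)
  then show ?thesis by eventually_elim auto
qed

lemma lattice_sum_asymp:
  assumes \<alpha>: "\<alpha> > real CARD('d::finite)"
  defines "p \<equiv> real CARD('d) / \<alpha>"
  shows "mono (lattice_sum TYPE('d) \<alpha>)" "0 \<le> lattice_sum TYPE('d) \<alpha> u"
    "\<exists>K. \<forall>u\<ge>0. lattice_sum TYPE('d) \<alpha> u \<le> K * u powr p"
    "((\<lambda>u. lattice_sum TYPE('d) \<alpha> u / u powr p) \<longlongrightarrow> unit_ball_vol (real CARD('d)) * Gamma (1 - p)) at_top"
proof -
  have a0: "\<alpha> > 0" using \<alpha> by (metis of_nat_0_le_iff order_le_less_trans)
  have p: "0 < p" "p < 1" using \<alpha> a0 by (auto simp: p_def)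
  obtain K where K: "\<And>y. y \<ge> 0 \<Longrightarrow> lattice_count TYPE('d) \<alpha> y \<le> K * y powr p"
    using lattice_count_bound[OF a0, where 'd='d] unfolding p_def by blast
  have nn: "0 \<le> lattice_count TYPE('d) \<alpha> y" for y by (simp add: lattice_count_def)
  let ?Z = "\<lambda>e::real. if 0 < e then 1 / e else 0"
  have Z: "?Z \<in> borel_measurable (density lborel (exponential_density 1))" by simp
  have Z0: "0 \<le> ?Z e" for e by simp
  note I = integrable_inverse_exponential[OF p]
  note bounds = scaled_expectation_bounds[OF lattice_count_mono[OF a0, where 'd='d] nn K Z Z0 I(1)]
  show "mono (lattice_sum TYPE('d) \<alpha>)"
    unfolding lattice_sum_def by (intro monoI bounds(4)) auto
  show "0 \<le> lattice_sum TYPE('d) \<alpha> u" unfolding lattice_sum_def by (rule bounds(3))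
  show "\<exists>K. \<forall>u\<ge>0. lattice_sum TYPE('d) \<alpha> u \<le> K * u powr p"
    using bounds(2) unfolding lattice_sum_def by (auto simp: max_absorb2)
  have "((\<lambda>u. (\<integral>e. lattice_count TYPE('d) \<alpha> (u * ?Z e) \<partial>density lborel (exponential_density 1)) / u powr p)
      \<longlongrightarrow> unit_ball_vol (real CARD('d)) * (\<integral>e. ?Z e powr p \<partial>density lborel (exponential_density 1))) at_top"
    by (rule scaled_expectation_asymp[OF lattice_count_mono[OF a0, where 'd='d] nn K _ Z Z0 I(1) p(1)])
       (auto intro!: lattice_count_asymp[OF a0] simp: p_def)
  moreover have "\<forall>\<^sub>F u in at_top. (\<integral>e. lattice_count TYPE('d) \<alpha> (u * ?Z e) \<partial>density lborel (exponential_density 1)) / u powr p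
      = lattice_sum TYPE('d) \<alpha> u / u powr p"
    using eventually_gt_at_top[of 0] by eventually_elim (simp add: lattice_sum_def max_absorb2)
  ultimately show "((\<lambda>u. lattice_sum TYPE('d) \<alpha> u / u powr p) \<longlongrightarrow> unit_ball_vol (real CARD('d)) * Gamma (1 - p)) at_top"
    unfolding I(2) by (rule Lim_transform_eventually)
qed

text \<open>A finite partial sum over \<open>B\<close> is the expected number of points of \<open>B\<close> below the random level
  \<open>u / T\<close>. It is dominated by the full count, and along the exhaustion by boxes it is eventually
  equal to it for each value of \<open>T\<close>.\<close>

lemma lattice_sum_series:
  assumes \<alpha>: "\<alpha> > real CARD('d::finite)" and u: "u \<ge> 0"
  defines "S \<equiv> (\<lambda>B. \<Sum>x\<in>B. 1 - exp (- u / lattice_dist 0 (x :: int ^ 'd) powr \<alpha>))"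
  shows "finite B \<Longrightarrow> 0 \<notin> B \<Longrightarrow> S B \<le> lattice_sum TYPE('d) \<alpha> u"
    "(\<lambda>n. S (lattice_box n)) \<longlonglongrightarrow> lattice_sum TYPE('d) \<alpha> u"
proof -
  have a0: "\<alpha> > 0" using \<alpha> by (metis of_nat_0_le_iff order_le_less_trans)
  define p where "p = real CARD('d) / \<alpha>"
  have p: "0 < p" "p < 1" using \<alpha> a0 by (auto simp: p_def)
  obtain K where K: "\<And>y. y \<ge> 0 \<Longrightarrow> lattice_count TYPE('d) \<alpha> y \<le> K * y powr p"
    using lattice_count_bound[OF a0, where 'd='d] unfolding p_def by blast
  have nn: "0 \<le> lattice_count TYPE('d) \<alpha> y" for y by (simp add: lattice_count_def)
  define E where "E = density lborel (exponential_density 1)"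
  interpret E: prob_space E unfolding E_def by (rule prob_space_exponential_density) simp
  define Z where "Z = (\<lambda>e::real. if 0 < e then 1 / e else 0)"
  have Zm: "Z \<in> borel_measurable E" by (simp add: Z_def E_def)
  have Z0: "0 \<le> Z e" for e by (simp add: Z_def)
  have I: "integrable E (\<lambda>e. Z e powr p)"
    using integrable_inverse_exponential(1)[OF p] by (simp add: E_def Z_def)
  note bounds = scaled_expectation_bounds[OF lattice_count_mono[OF a0, where 'd='d] nn K Zm Z0 I]
  have int: "integrable E (\<lambda>e. lattice_count TYPE('d) \<alpha> (u * Z e))" by (rule bounds(1)) (use u in auto)
  have S: "lattice_sum TYPE('d) \<alpha> u = (\<integral>e. lattice_count TYPE('d) \<alpha> (u * Z e) \<partial>E)"
    using u by (simp add: lattice_sum_def E_def Z_def max_absorb2)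
  define c where "c B e = (\<Sum>x\<in>B. indicator {e. lattice_dist 0 (x :: int ^ 'd) powr \<alpha> < u * Z e} e :: real)" for B e
  have setm: "{e. lattice_dist 0 x powr \<alpha> < u * Z e} \<in> sets E" for x :: "int ^ 'd"
  proof -
    have "{e \<in> space E. lattice_dist 0 x powr \<alpha> < u * Z e} \<in> sets E" using Zm by measurable
    moreover have "space E = UNIV" by (simp add: E_def)
    ultimately show ?thesis by simp
  qed
  have "integrable E (indicator A :: real \<Rightarrow> real)" if "A \<in> sets E" for A
    using that by (intro E.integrable_const_bound[where B = 1]) (auto split: split_indicator)
  from this[OF setm]
  have ind: "integrable E (indicator {e. lattice_dist 0 x powr \<alpha> < u * Z e} :: real \<Rightarrow> real)" for x :: "int ^ 'd" .
  have cint: "integrable E (c B)" for B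
    unfolding c_def by (intro Bochner_Integration.integrable_sum ind)
  have cS: "(\<integral>e. c B e \<partial>E) = S B" if "0 \<notin> B" for B
  proof -
    have "(\<integral>e. c B e \<partial>E) = (\<Sum>x\<in>B. \<integral>e. indicator {e. lattice_dist 0 x powr \<alpha> < u * Z e} e \<partial>E)"
      unfolding c_def by (intro Bochner_Integration.integral_sum ind)
    also have "\<dots> = S B"
      unfolding S_def
    proof (rule sum.cong[OF refl])
      fix x assume "x \<in> B"
      then have "x \<noteq> 0" using that by auto
      from lattice_dist_ge_1[OF this] have "0 < lattice_dist 0 x powr \<alpha>" by simp
      from exponential_threshold[OF u this]
      show "(\<integral>e. indicator {e. lattice_dist 0 x powr \<alpha> < u * Z e} e \<partial>E) = 1 - exp (- u / lattice_dist 0 x powr \<alpha>)"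
        by (simp add: E_def Z_def)
    qed
    finally show ?thesis .
  qed
  have ccard: "c B e = real (card {x \<in> B. lattice_dist 0 x powr \<alpha> < u * Z e})" if "finite B" for B e
  proof -
    have "c B e = (\<Sum>x\<in>B. if lattice_dist 0 x powr \<alpha> < u * Z e then 1 else 0)"
      unfolding c_def by (intro sum.cong) (auto simp: indicator_def)
    also have "\<dots> = (\<Sum>x | x \<in> B \<and> lattice_dist 0 x powr \<alpha> < u * Z e. 1)"
      by (rule sum.inter_filter[OF that, symmetric])
    finally show ?thesis by simp
  qed
  have cle: "c B e \<le> lattice_count TYPE('d) \<alpha> (u * Z e)" if "finite B" "0 \<notin> B" for B e
    unfolding ccard[OF that(1)] lattice_count_def
    using that by (intro of_nat_mono card_mono finite_lattice_powr a0) auto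
  show "S B \<le> lattice_sum TYPE('d) \<alpha> u" if "finite B" "0 \<notin> B"
    unfolding cS[OF that(2), symmetric] S using that by (intro integral_mono cint int cle)
  have box: "finite (lattice_box n :: (int ^ 'd) set)" "0 \<notin> (lattice_box n :: (int ^ 'd) set)" for n
    using finite_lattice_box by (auto simp: lattice_box_def)
  have "(\<lambda>n. \<integral>e. c (lattice_box n) e \<partial>E) \<longlonglongrightarrow> (\<integral>e. lattice_count TYPE('d) \<alpha> (u * Z e) \<partial>E)"
  proof (rule integral_dominated_convergence[OF _ _ int])
    show "AE e in E. norm (c (lattice_box n) e) \<le> lattice_count TYPE('d) \<alpha> (u * Z e)" for n
    proof (rule AE_I2)
      fix e
      have "0 \<le> c (lattice_box n) e" by (simp add: c_def sum_nonneg)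
      then show "norm (c (lattice_box n) e) \<le> lattice_count TYPE('d) \<alpha> (u * Z e)"
        using cle[OF box, of n e] by simp
    qed
    show "AE e in E. (\<lambda>n. c (lattice_box n) e) \<longlonglongrightarrow> lattice_count TYPE('d) \<alpha> (u * Z e)"
    proof (rule AE_I2, rule tendsto_eventually)
      fix e
      let ?A = "{x :: int ^ 'd. x \<noteq> 0 \<and> lattice_dist 0 x powr \<alpha> < u * Z e}"
      have "\<forall>\<^sub>F n in sequentially. ?A \<subseteq> lattice_box n"
        by (intro lattice_box_exhausts finite_lattice_powr a0) auto
      then show "\<forall>\<^sub>F n in sequentially. c (lattice_box n) e = lattice_count TYPE('d) \<alpha> (u * Z e)"
      proof eventually_elim
        case (elim n)
        then have "{x \<in> lattice_box n. lattice_dist 0 x powr \<alpha> < u * Z e} = ?A"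
          using box(2)[of n] by auto
        then show ?case by (simp add: ccard[OF box(1)] lattice_count_def)
      qed
    qed
  qed (use cint int in auto)
  then show "(\<lambda>n. S (lattice_box n)) \<longlonglongrightarrow> lattice_sum TYPE('d) \<alpha> u"
    by (simp add: cS[OF box(2)] S)
qed

text \<open>The function \<open>m\<close> is the mean degree of the origin when its weight is \<open>w\<close>, and \<open>Z\<close> stands for
  \<open>\<lambda>W\<close>. Its asymptotics follow from those of \<open>lattice_sum\<close> by averaging over \<open>Z\<close>. Only the partial
  sums over finite boxes occur in the probabilistic estimates, so the conclusion bounds them by
  \<open>m\<close> and identifies their limit.\<close>

lemma expected_degree:
  fixes Z :: "'a \<Rightarrow> real"
  assumes M: "prob_space M" and \<alpha>: "\<alpha> > real CARD('d::finite)"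
  defines "p \<equiv> real CARD('d) / \<alpha>"
  assumes Z: "Z \<in> borel_measurable M" "\<And>\<omega>. \<omega> \<in> space M \<Longrightarrow> 0 \<le> Z \<omega>" "integrable M (\<lambda>\<omega>. Z \<omega> powr p)"
    and nz: "\<not> (AE \<omega> in M. Z \<omega> = 0)"
  defines "q \<equiv> (\<lambda>w (x :: int ^ 'd). \<integral>\<omega>. 1 - exp (- (w * Z \<omega>) / lattice_dist 0 x powr \<alpha>) \<partial>M)"
  shows "\<exists>m C. 0 < C \<and> ((\<lambda>w. m w / w powr p) \<longlongrightarrow> C) at_top \<and>
     (\<forall>w\<ge>0. (\<forall>n. (\<Sum>x\<in>lattice_box n. q w x) \<le> m w) \<and> (\<lambda>n. \<Sum>x\<in>lattice_box n. q w x) \<longlonglongrightarrow> m w)"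
proof -
  interpret prob_space M by fact
  note [measurable] = Z(1)
  have a0: "\<alpha> > 0" using \<alpha> by (metis of_nat_0_le_iff order_le_less_trans)
  have p: "0 < p" "p < 1" using \<alpha> a0 by (auto simp: p_def)
  note LS = lattice_sum_asymp[OF \<alpha>, folded p_def]
  obtain K where K: "\<And>u. u \<ge> 0 \<Longrightarrow> lattice_sum TYPE('d) \<alpha> u \<le> K * u powr p" using LS(3) by blast
  note bounds = scaled_expectation_bounds[OF LS(1,2) K Z]
  define m where "m w = (\<integral>\<omega>. lattice_sum TYPE('d) \<alpha> (w * Z \<omega>) \<partial>M)" for w
  define EZ where "EZ = (\<integral>\<omega>. Z \<omega> powr p \<partial>M)"
  have "EZ \<noteq> 0"
  proof
    assume "EZ = 0"
    then have "AE \<omega> in M. Z \<omega> powr p = 0"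
      using integral_nonneg_eq_0_iff_AE[OF Z(3)] by (simp add: EZ_def)
    with nz show False by (simp add: powr_eq_0_iff)
  qed
  moreover have "EZ \<ge> 0" by (simp add: EZ_def)
  ultimately have "EZ > 0" by simp
  moreover have "unit_ball_vol (real CARD('d)) > 0" by simp
  moreover have "Gamma (1 - p) > 0" using p by (intro Gamma_real_pos) simp
  ultimately have C: "unit_ball_vol (real CARD('d)) * Gamma (1 - p) * EZ > 0" by simp
  have lim: "((\<lambda>w. m w / w powr p) \<longlongrightarrow> unit_ball_vol (real CARD('d)) * Gamma (1 - p) * EZ) at_top"
    unfolding m_def EZ_def by (rule scaled_expectation_asymp[OF LS(1,2) K LS(4) Z p(1)])
  have box: "finite (lattice_box n :: (int ^ 'd) set)" "0 \<notin> (lattice_box n :: (int ^ 'd) set)" for n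
    using finite_lattice_box by (auto simp: lattice_box_def)
  have le1: "0 \<le> 1 - exp (- (w * Z \<omega>) / lattice_dist 0 (x::int^'d) powr \<alpha>)"
     "1 - exp (- (w * Z \<omega>) / lattice_dist 0 (x::int^'d) powr \<alpha>) \<le> 1"
     if "w \<ge> 0" "\<omega> \<in> space M" for w \<omega> x using that Z(2)[OF that(2)] by (auto simp: divide_nonpos_nonneg)
  define s where "s w n \<omega> = (\<Sum>x\<in>(lattice_box n :: (int ^ 'd) set). 1 - exp (- (w * Z \<omega>) / lattice_dist 0 x powr \<alpha>))" for w n \<omega>
  have smain: "(\<forall>n. (\<Sum>x\<in>lattice_box n. q w x) \<le> m w) \<and> (\<lambda>n. \<Sum>x\<in>lattice_box n. q w x) \<longlonglongrightarrow> m w"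
    if w: "w \<ge> 0" for w
  proof -
    have int1: "integrable M (\<lambda>\<omega>. 1 - exp (- (w * Z \<omega>) / lattice_dist 0 x powr \<alpha>))" for x :: "int ^ 'd"
      by (rule integrable_const_bound[where B = 1]) (use le1[OF w] in \<open>auto intro!: AE_I2\<close>)
    have sint: "integrable M (s w n)" for n
      unfolding s_def by (intro Bochner_Integration.integrable_sum int1)
    have sq: "(\<integral>\<omega>. s w n \<omega> \<partial>M) = (\<Sum>x\<in>lattice_box n. q w x)" for n
      unfolding s_def q_def by (intro Bochner_Integration.integral_sum int1)
    have int: "integrable M (\<lambda>\<omega>. lattice_sum TYPE('d) \<alpha> (w * Z \<omega>))" by (rule bounds(1)) (use w in auto)
    have sle: "s w n \<omega> \<le> lattice_sum TYPE('d) \<alpha> (w * Z \<omega>)" if "\<omega> \<in> space M" for n \<omega>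
      unfolding s_def using w Z(2)[OF that] by (intro lattice_sum_series(1) \<alpha> box) auto
    have "(\<lambda>n. \<integral>\<omega>. s w n \<omega> \<partial>M) \<longlonglongrightarrow> m w"
      unfolding m_def
    proof (rule integral_dominated_convergence[OF _ _ int])
      show "AE \<omega> in M. norm (s w n \<omega>) \<le> lattice_sum TYPE('d) \<alpha> (w * Z \<omega>)" for n
      proof (rule AE_I2)
        fix \<omega> assume \<omega>: "\<omega> \<in> space M"
        have "0 \<le> s w n \<omega>" unfolding s_def by (intro sum_nonneg le1 w \<omega>)
        then show "norm (s w n \<omega>) \<le> lattice_sum TYPE('d) \<alpha> (w * Z \<omega>)" using sle[OF \<omega>, of n] by simp
      qed
      show "AE \<omega> in M. (\<lambda>n. s w n \<omega>) \<longlonglongrightarrow> lattice_sum TYPE('d) \<alpha> (w * Z \<omega>)"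
        unfolding s_def using w Z(2) by (intro AE_I2 lattice_sum_series(2) \<alpha>) auto
    qed (use sint int in auto)
    moreover have "(\<integral>\<omega>. s w n \<omega> \<partial>M) \<le> m w" for n
      unfolding m_def by (intro integral_mono sint int sle)
    ultimately show ?thesis by (simp add: sq)
  qed
  show ?thesis using C lim smain by blast
qed

section \<open>Chernoff bounds for the degree\<close>

locale weighted_percolation = prob_space M
  for M :: "'a measure" 
    and W :: "int ^ 'd::finite \<Rightarrow> 'a \<Rightarrow> real"
    and G :: "'a \<Rightarrow> (int ^ 'd) set set"
    and lam \<alpha> :: real +
  assumes lam: "lam > 0"
    and alpha: "\<alpha> > real CARD('d)"
    and indep: "indep_vars (\<lambda>_. borel) W UNIV"
    and identical: "distr M borel (W x) = distr M borel (W 0)"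
    and weight_nonneg: "\<omega> \<in> space M \<Longrightarrow> 0 \<le> W x \<omega>"
    and cond_indep: "cond_indep_events M (generated_sigma M W)
           (\<lambda>e. {\<omega> \<in> space M. e \<in> G \<omega>}) potential_edges"
    and cond_prob: "x \<noteq> y \<Longrightarrow>
           (AE \<omega> in M. cond_prob_given M (generated_sigma M W) {\<omega> \<in> space M. {x, y} \<in> G \<omega>} \<omega> =
              1 - exp (- (lam * W x \<omega> * W y \<omega> / lattice_dist x y powr \<alpha>)))"
begin

text \<open>In \<open>edge_prob v x y\<close>, \<open>v\<close> is the weight of the origin and \<open>y\<close> that of \<open>x\<close>.\<close>

definition edge_prob :: "real \<Rightarrow> int ^ 'd \<Rightarrow> real \<Rightarrow> real" where
  "edge_prob v x y = 1 - exp (- (v * (lam * y)) / lattice_dist 0 x powr \<alpha>)"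

definition edge_event :: "int ^ 'd \<Rightarrow> 'a set" where
  "edge_event x = {\<omega> \<in> space M. {0, x} \<in> G \<omega>}"

text \<open>The probability of the edge to \<open>x\<close> when the origin has weight \<open>v\<close>. Averaging over \<open>W\<^sub>0\<close> instead
  of \<open>W\<^sub>x\<close> is harmless, as the weights have the same distribution.\<close>

definition mean_prob :: "real \<Rightarrow> int ^ 'd \<Rightarrow> real" where
  "mean_prob v x = (\<integral>\<omega>. edge_prob v x (W 0 \<omega>) \<partial>M)"

definition degree_in :: "(int ^ 'd) set \<Rightarrow> 'a \<Rightarrow> nat" where
  "degree_in B \<omega> = card {x \<in> B. {0, x} \<in> G \<omega>}"

lemma W_measurable [measurable]: "W x \<in> borel_measurable M"
  using indep by (auto simp: indep_vars_def)

lemma edge_prob_measurable [measurable]: "edge_prob v x \<in> borel_measurable borel"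
  unfolding edge_prob_def by measurable

lemma edge_prob_bounds: "0 \<le> v \<Longrightarrow> 0 \<le> y \<Longrightarrow> 0 \<le> edge_prob v x y" "edge_prob v x y \<le> 1"
  using lam by (auto simp: edge_prob_def divide_nonpos_nonneg)

lemma edge_prob_mono: "0 \<le> y \<Longrightarrow> v \<le> w \<Longrightarrow> edge_prob v x y \<le> edge_prob w x y"
  unfolding edge_prob_def using lam
  by (auto intro!: divide_right_mono mult_right_mono)

lemma potential_edge: "x \<noteq> 0 \<Longrightarrow> {0, x} \<in> (potential_edges :: (int ^ 'd) set set)"
  unfolding potential_edges_def by blast

lemma edge_event_sets: "x \<noteq> 0 \<Longrightarrow> edge_event x \<in> sets M"
  using cond_indep potential_edge unfolding cond_indep_events_def edge_event_def by blast

lemma subalgebra_generated: "subalgebra M (generated_sigma M W)"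
  unfolding subalgebra_def generated_sigma_def
proof (intro conjI)
  show "space (vimage_algebra (space M) (\<lambda>\<omega> i. W i \<omega>) (Pi\<^sub>M UNIV (\<lambda>_. borel))) = space M" by simp
  have "(\<lambda>\<omega> i. W i \<omega>) \<in> measurable M (Pi\<^sub>M UNIV (\<lambda>_. borel))"
    by (rule measurable_PiM_single') auto
  then show "sets (vimage_algebra (space M) (\<lambda>\<omega> i. W i \<omega>) (Pi\<^sub>M UNIV (\<lambda>_. borel))) \<subseteq> sets M"
    by (auto simp: sets_vimage_algebra2 measurable_sets space_PiM)
qed

lemma W_measurable_generated: "W x \<in> borel_measurable (generated_sigma M W)"
proof -
  have "(\<lambda>\<omega> i. W i \<omega>) \<in> measurable (generated_sigma M W) (Pi\<^sub>M UNIV (\<lambda>_. borel))"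
    unfolding generated_sigma_def by (rule measurable_vimage_algebra1) (auto simp: space_PiM)
  from measurable_compose[OF this measurable_component_singleton[of x]] show ?thesis by simp
qed

text \<open>The event \<open>W\<^sub>0 \<in> A\<close> is measurable with respect to the weights, so it can be moved into the
  conditional expectation, where the conditional independence of the edges produces the product.\<close>

lemma joint_edge_probability:
  assumes A: "A \<in> sets borel" and J: "finite J" "0 \<notin> J"
  shows "(\<integral>\<omega>. indicator {\<omega> \<in> space M. W 0 \<omega> \<in> A} \<omega> * (\<Prod>x\<in>J. indicator (edge_event x) \<omega>) \<partial>M)
       = (\<integral>\<omega>. indicator {\<omega> \<in> space M. W 0 \<omega> \<in> A} \<omega> * (\<Prod>x\<in>J. edge_prob (W 0 \<omega>) x (W x \<omega>)) \<partial>M)"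
proof (cases "J = {}")
  case False
  let ?N = "generated_sigma M W"
  let ?g = "indicator {\<omega> \<in> space M. W 0 \<omega> \<in> A} :: 'a \<Rightarrow> real"
  interpret N: finite_measure_subalgebra M ?N
    by unfold_locales (rule subalgebra_generated)
  have spN: "space ?N = space M" using subalgebra_generated by (simp add: subalgebra_def)
  have gN: "?g \<in> borel_measurable ?N"
  proof (rule borel_measurable_indicator)
    have "{\<omega> \<in> space ?N. W 0 \<omega> \<in> A} \<in> sets ?N" using A W_measurable_generated[of 0] by measurable
    then show "{\<omega> \<in> space M. W 0 \<omega> \<in> A} \<in> sets ?N" by (simp add: spN)
  qed
  define I where "I = (\<lambda>x. {0, x}) ` J"
  have inj: "inj_on (\<lambda>x. {0, x}) J" by (auto simp: inj_on_def doubleton_eq_iff)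
  have I: "finite I" "I \<noteq> {}" "I \<subseteq> potential_edges"
    using J False potential_edge unfolding I_def by (simp, simp, metis image_subsetI)
  let ?E = "\<lambda>e. {\<omega> \<in> space M. e \<in> G \<omega>}"
  let ?C = "\<Inter>e\<in>I. ?E e"
  have Es: "?E e \<in> sets M" if "e \<in> I" for e
    using cond_indep I that unfolding cond_indep_events_def by blast
  have C: "?C \<in> sets M" using I Es by (intro sets.finite_INT) auto
  have ind: "(\<Prod>x\<in>J. indicator (edge_event x) \<omega>) = (indicator ?C \<omega> :: real)" for \<omega>
  proof -
    have "(\<Prod>x\<in>J. indicator (edge_event x) \<omega>) = (indicator (\<Inter>x\<in>J. edge_event x) \<omega> :: real)"
      using J(1) False by (induction J rule: finite_ne_induct) (auto simp: indicator_inter_arith)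
    also have "(\<Inter>x\<in>J. edge_event x) = ?C" by (simp add: I_def edge_event_def)
    finally show ?thesis .
  qed
  have "AE \<omega> in M. cond_prob_given M ?N ?C \<omega> = (\<Prod>e\<in>I. cond_prob_given M ?N (?E e) \<omega>)"
    using cond_indep I unfolding cond_indep_events_def by blast
  moreover have "AE \<omega> in M. \<forall>x\<in>J. cond_prob_given M ?N (?E {0, x}) \<omega> =
              1 - exp (- (lam * W 0 \<omega> * W x \<omega> / lattice_dist 0 x powr \<alpha>))"
    using J by (intro AE_finite_allI cond_prob) auto
  ultimately have ae: "AE \<omega> in M. real_cond_exp M ?N (indicator ?C) \<omega> = (\<Prod>x\<in>J. edge_prob (W 0 \<omega>) x (W x \<omega>))"
  proof eventually_elim
    case (elim \<omega>)
    then show ?case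
      by (simp add: I_def prod.reindex[OF inj] cond_prob_given_def edge_prob_def mult_ac)
  qed
  have "(\<integral>\<omega>. ?g \<omega> * (\<Prod>x\<in>J. indicator (edge_event x) \<omega>) \<partial>M) = (\<integral>\<omega>. ?g \<omega> * indicator ?C \<omega> \<partial>M)"
    by (simp add: ind)
  also have "\<dots> = (\<integral>\<omega>. ?g \<omega> * real_cond_exp M ?N (indicator ?C) \<omega> \<partial>M)"
  proof (rule N.real_cond_exp_intg(2)[symmetric])
    show "integrable M (\<lambda>\<omega>. ?g \<omega> * indicator ?C \<omega>)"
      using C measurable_from_subalg[OF subalgebra_generated gN]
      by (intro integrable_const_bound[where B = 1]) (auto split: split_indicator)
  qed (use gN C in auto)
  also have "\<dots> = (\<integral>\<omega>. ?g \<omega> * (\<Prod>x\<in>J. edge_prob (W 0 \<omega>) x (W x \<omega>)) \<partial>M)"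
  proof (rule integral_cong_AE)
    show "(\<lambda>\<omega>. ?g \<omega> * real_cond_exp M ?N (indicator ?C) \<omega>) \<in> borel_measurable M"
      using measurable_from_subalg[OF subalgebra_generated gN] by (intro borel_measurable_times) auto
    show "(\<lambda>\<omega>. ?g \<omega> * (\<Prod>x\<in>J. edge_prob (W 0 \<omega>) x (W x \<omega>))) \<in> borel_measurable M"
      using measurable_from_subalg[OF subalgebra_generated gN] 
      by (intro borel_measurable_times borel_measurable_prod) (auto simp: edge_prob_def)
    show "AE \<omega> in M. ?g \<omega> * real_cond_exp M ?N (indicator ?C) \<omega> = ?g \<omega> * (\<Prod>x\<in>J. edge_prob (W 0 \<omega>) x (W x \<omega>))"
      using ae by eventually_elim simp
  qed
  finally show ?thesis .
qed simp

text \<open>Expanding the product turns each side into a linear combination over \<open>J \<subseteq> B\<close> of the integrals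
  in \<open>joint_edge_probability\<close>. Since this is an identity and not an estimate, \<open>c\<close> may be negative.\<close>

lemma edge_generating_function:
  assumes A: "A \<in> sets borel" and B: "finite B" "0 \<notin> B"
  shows "(\<integral>\<omega>. indicator {\<omega> \<in> space M. W 0 \<omega> \<in> A} \<omega> * (\<Prod>x\<in>B. 1 + c * indicator (edge_event x) \<omega>) \<partial>M)
       = (\<integral>\<omega>. indicator {\<omega> \<in> space M. W 0 \<omega> \<in> A} \<omega> * (\<Prod>x\<in>B. 1 + c * edge_prob (W 0 \<omega>) x (W x \<omega>)) \<partial>M)"
proof -
  let ?g = "indicator {\<omega> \<in> space M. W 0 \<omega> \<in> A} :: 'a \<Rightarrow> real"
  have gM: "?g \<in> borel_measurable M" using A by measurable
  have expand: "?g \<omega> * (\<Prod>x\<in>B. 1 + c * f x) = (\<Sum>J\<in>Pow B. c ^ card J * (?g \<omega> * (\<Prod>x\<in>J. f x)))" for f :: "int ^ 'd \<Rightarrow> real" and \<omega>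
  proof -
    have "(\<Prod>x\<in>B. 1 + c * f x) = (\<Prod>x\<in>B. c * f x + 1)" by (simp add: add.commute)
    also have "\<dots> = (\<Sum>J\<in>Pow B. c ^ card J * (\<Prod>x\<in>J. f x))"
      by (subst prod_add[OF B(1)]) (simp add: prod.distrib)
    finally show ?thesis by (simp only: sum_distrib_left mult.left_commute)
  qed
  have int: "integrable M (\<lambda>\<omega>. c ^ card J * (?g \<omega> * (\<Prod>x\<in>J. f x \<omega>)))"
    if "finite J" "\<And>x. x \<in> J \<Longrightarrow> f x \<in> borel_measurable M"
       "\<And>x \<omega>. \<omega> \<in> space M \<Longrightarrow> 0 \<le> f x \<omega>" "\<And>x \<omega>. \<omega> \<in> space M \<Longrightarrow> f x \<omega> \<le> 1" for J and f :: "int ^ 'd \<Rightarrow> 'a \<Rightarrow> real"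
  proof (rule integrable_mult_right, rule integrable_const_bound[where B = 1])
    show "AE \<omega> in M. norm (?g \<omega> * (\<Prod>x\<in>J. f x \<omega>)) \<le> 1"
    proof (rule AE_I2)
      fix \<omega> assume "\<omega> \<in> space M"
      then have "0 \<le> (\<Prod>x\<in>J. f x \<omega>)" "(\<Prod>x\<in>J. f x \<omega>) \<le> 1"
        using that by (auto intro: prod_nonneg prod_le_1)
      then show "norm (?g \<omega> * (\<Prod>x\<in>J. f x \<omega>)) \<le> 1" by (auto split: split_indicator)
    qed
    show "(\<lambda>\<omega>. ?g \<omega> * (\<Prod>x\<in>J. f x \<omega>)) \<in> borel_measurable M"
      using gM that by (intro borel_measurable_times borel_measurable_prod) auto
  qed
  have fin: "finite J" "0 \<notin> J" if "J \<in> Pow B" for J using that B by (auto intro: finite_subset)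
  have ev: "indicator (edge_event x) \<in> borel_measurable M" if "x \<in> J" "J \<in> Pow B" for x J
    using fin(2)[OF that(2)] that(1) by (intro borel_measurable_indicator edge_event_sets) auto
  have pm: "(\<lambda>\<omega>. edge_prob (W 0 \<omega>) x (W x \<omega>)) \<in> borel_measurable M" for x
    unfolding edge_prob_def by measurable
  have "(\<integral>\<omega>. ?g \<omega> * (\<Prod>x\<in>B. 1 + c * indicator (edge_event x) \<omega>) \<partial>M)
     = (\<Sum>J\<in>Pow B. \<integral>\<omega>. c ^ card J * (?g \<omega> * (\<Prod>x\<in>J. indicator (edge_event x) \<omega>)) \<partial>M)"
    unfolding expand using fin(1) ev by (intro Bochner_Integration.integral_sum int) auto
  also have "\<dots> = (\<Sum>J\<in>Pow B. \<integral>\<omega>. c ^ card J * (?g \<omega> * (\<Prod>x\<in>J. edge_prob (W 0 \<omega>) x (W x \<omega>))) \<partial>M)"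
    using joint_edge_probability[OF A fin] by (intro sum.cong) auto
  also have "\<dots> = (\<integral>\<omega>. ?g \<omega> * (\<Prod>x\<in>B. 1 + c * edge_prob (W 0 \<omega>) x (W x \<omega>)) \<partial>M)"
    unfolding expand using fin(1)
    by (intro Bochner_Integration.integral_sum[symmetric] int pm edge_prob_bounds weight_nonneg) auto
  finally show ?thesis .
qed

lemma mean_prob_eq: "mean_prob v x = (\<integral>\<omega>. edge_prob v x (W y \<omega>) \<partial>M)"
proof -
  have "(\<integral>\<omega>. edge_prob v x (W y \<omega>) \<partial>M) = (\<integral>u. edge_prob v x u \<partial>distr M borel (W y))"
    by (subst integral_distr) auto
  also have "\<dots> = (\<integral>u. edge_prob v x u \<partial>distr M borel (W 0))" by (subst identical) (rule refl)
  also have "\<dots> = mean_prob v x" unfolding mean_prob_def by (subst integral_distr) auto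
  finally show ?thesis by simp
qed

text \<open>The weight \<open>W\<^sub>0\<close> couples the factors of the product. Replacing it by the threshold \<open>w\<close>, which the
  hypothesis \<open>cmp\<close> makes an upper estimate (\<open>A\<close> lies below \<open>w\<close> if \<open>c > 0\<close>, above \<open>w\<close> if \<open>c < 0\<close>),
  leaves a product of functions of the separate weights. Its expectation factorises by
  independence; the vertex 0 carries the factor for \<open>W\<^sub>0 \<in> A\<close>.\<close>

lemma generating_function_bound:
  assumes A: "A \<in> sets borel" and B: "finite B" "0 \<notin> B" and w: "0 \<le> w" and c: "-1 \<le> c"
    and cmp: "\<And>v. v \<in> A \<Longrightarrow> c * v \<le> c * w"
  shows "(\<integral>\<omega>. indicator {\<omega> \<in> space M. W 0 \<omega> \<in> A} \<omega> * (\<Prod>x\<in>B. 1 + c * indicator (edge_event x) \<omega>) \<partial>M)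
     \<le> prob {\<omega> \<in> space M. W 0 \<omega> \<in> A} * exp (c * (\<Sum>x\<in>B. mean_prob w x))"
proof -
  let ?g = "indicator {\<omega> \<in> space M. W 0 \<omega> \<in> A} :: 'a \<Rightarrow> real"
  let ?f = "\<lambda>x y. if x = 0 then indicator A y else 1 + c * edge_prob w x y"
  have pos: "0 \<le> 1 + c * u" "1 + c * u \<le> 1 + \<bar>c\<bar>" if "0 \<le> u" "u \<le> 1" for u :: real
  proof -
    have "\<bar>c * u\<bar> \<le> \<bar>c\<bar>" using that by (simp add: abs_mult mult_left_le)
    then show "1 + c * u \<le> 1 + \<bar>c\<bar>" by linarith
    have "- 1 * u \<le> c * u" using c that by (intro mult_right_mono) auto
    then show "0 \<le> 1 + c * u" using that by linarith
  qed
  have fm: "?f x \<in> borel_measurable borel" for x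
  proof (cases "x = 0")
    case True
    then have "?f x = indicator A" by auto
    with A show ?thesis by (simp only: borel_measurable_indicator)
  next
    case False
    have "(\<lambda>y. 1 + c * edge_prob w x y) \<in> borel_measurable borel" by measurable
    then show ?thesis using False by (simp only: if_False)
  qed
  have fint: "integrable M (\<lambda>\<omega>. ?f x (W x \<omega>))" for x
  proof (rule integrable_const_bound[where B = "1 + \<bar>c\<bar>"])
    show "AE \<omega> in M. norm (?f x (W x \<omega>)) \<le> 1 + \<bar>c\<bar>"
    proof (rule AE_I2)
      fix \<omega> assume "\<omega> \<in> space M"
      then have e: "0 \<le> edge_prob w x (W x \<omega>)" "edge_prob w x (W x \<omega>) \<le> 1"
        using edge_prob_bounds(1)[OF w weight_nonneg] edge_prob_bounds(2) by blast+
      have "norm (indicator A (W x \<omega>) :: real) \<le> 1 + \<bar>c\<bar>" by (simp split: split_indicator)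
      moreover have "norm (1 + c * edge_prob w x (W x \<omega>)) \<le> 1 + \<bar>c\<bar>"
        using pos[OF e] by (simp only: real_norm_def abs_of_nonneg)
      ultimately show "norm (?f x (W x \<omega>)) \<le> 1 + \<bar>c\<bar>" by (simp only: split: if_split) blast
    qed
  qed (rule measurable_compose[OF W_measurable fm])
  have ind: "indep_vars (\<lambda>_. borel) (\<lambda>x \<omega>. ?f x (W x \<omega>)) (insert 0 B)"
    using indep_vars_compose2[OF indep_vars_subset[OF indep subset_UNIV], of "insert 0 B" ?f "\<lambda>_. borel"] fm
    by blast
  have prodf: "(\<Prod>x\<in>insert 0 B. ?f x (W x \<omega>)) = indicator A (W 0 \<omega>) * (\<Prod>x\<in>B. 1 + c * edge_prob w x (W x \<omega>))" for \<omega>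
  proof -
    have "(\<Prod>x\<in>B. ?f x (W x \<omega>)) = (\<Prod>x\<in>B. 1 + c * edge_prob w x (W x \<omega>))"
      using B by (intro prod.cong) auto
    then show ?thesis by (simp only: prod.insert[OF B] simp_thms if_True)
  qed
  have "(\<integral>\<omega>. ?g \<omega> * (\<Prod>x\<in>B. 1 + c * indicator (edge_event x) \<omega>) \<partial>M)
     = (\<integral>\<omega>. ?g \<omega> * (\<Prod>x\<in>B. 1 + c * edge_prob (W 0 \<omega>) x (W x \<omega>)) \<partial>M)"
    by (rule edge_generating_function[OF A B])
  also have "\<dots> \<le> (\<integral>\<omega>. (\<Prod>x\<in>insert 0 B. ?f x (W x \<omega>)) \<partial>M)"
  proof (rule Bochner_Integration.integral_mono')
    show "integrable M (\<lambda>\<omega>. \<Prod>x\<in>insert 0 B. ?f x (W x \<omega>))"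
      using B fint by (intro indep_vars_integrable ind) auto
    fix \<omega> assume \<omega>: "\<omega> \<in> space M"
    note W = weight_nonneg[OF \<omega>]
    show "0 \<le> (\<Prod>x\<in>insert 0 B. ?f x (W x \<omega>))"
      unfolding prodf by (intro mult_nonneg_nonneg prod_nonneg pos edge_prob_bounds w W ballI) auto
    show "?g \<omega> * (\<Prod>x\<in>B. 1 + c * edge_prob (W 0 \<omega>) x (W x \<omega>)) \<le> (\<Prod>x\<in>insert 0 B. ?f x (W x \<omega>))"
    proof (cases "W 0 \<omega> \<in> A")
      case True
      have "c * edge_prob (W 0 \<omega>) x (W x \<omega>) \<le> c * edge_prob w x (W x \<omega>)" for x
      proof (cases "c \<ge> 0")
        case c: True
        show ?thesis
        proof (cases "c = 0")
          case False
          then have "W 0 \<omega> \<le> w" using cmp[OF True] c by (simp add: mult_le_cancel_left)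
          then show ?thesis using c W by (intro mult_left_mono edge_prob_mono) auto
        qed simp
      next
        case False
        then have "w \<le> W 0 \<omega>" using cmp[OF True] by (simp add: mult_le_cancel_left)
        then show ?thesis using False W by (intro mult_left_mono_neg edge_prob_mono) auto
      qed
      then have "(\<Prod>x\<in>B. 1 + c * edge_prob (W 0 \<omega>) x (W x \<omega>)) \<le> (\<Prod>x\<in>B. 1 + c * edge_prob w x (W x \<omega>))"
        by (intro prod_mono conjI pos edge_prob_bounds W add_left_mono)
      then show ?thesis unfolding prodf using True \<omega> by simp
    qed (simp add: prodf)
  qed
  also have "\<dots> = (\<Prod>x\<in>insert 0 B. \<integral>\<omega>. ?f x (W x \<omega>) \<partial>M)"
    using B fint by (intro indep_vars_lebesgue_integral ind) auto
  also have "\<dots> = prob {\<omega> \<in> space M. W 0 \<omega> \<in> A} * (\<Prod>x\<in>B. 1 + c * mean_prob w x)"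
  proof -
    have "(\<integral>\<omega>. ?f 0 (W 0 \<omega>) \<partial>M) = (\<integral>\<omega>. ?g \<omega> \<partial>M)"
      by (intro Bochner_Integration.integral_cong) (auto split: split_indicator)
    also have "\<dots> = prob {\<omega> \<in> space M. W 0 \<omega> \<in> A}"
      by (simp add: Int_absorb2 Collect_restrict)
    finally have 0: "(\<integral>\<omega>. ?f 0 (W 0 \<omega>) \<partial>M) = prob {\<omega> \<in> space M. W 0 \<omega> \<in> A}" .
    have "(\<integral>\<omega>. ?f x (W x \<omega>) \<partial>M) = 1 + c * mean_prob w x" if "x \<in> B" for x
    proof -
      have "x \<noteq> 0" using that B by auto
      moreover have "integrable M (\<lambda>\<omega>. edge_prob w x (W x \<omega>))"
        using w weight_nonneg edge_prob_bounds
        by (intro integrable_const_bound[where B = 1]) auto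
      ultimately show ?thesis by (simp add: mean_prob_eq[of w x x] prob_space)
    qed
    then have "(\<Prod>x\<in>B. \<integral>\<omega>. ?f x (W x \<omega>) \<partial>M) = (\<Prod>x\<in>B. 1 + c * mean_prob w x)"
      by (intro prod.cong) auto
    with 0 B show ?thesis by (simp only: prod.insert if_True not_False_eq_True)
  qed
  also have "\<dots> \<le> prob {\<omega> \<in> space M. W 0 \<omega> \<in> A} * (\<Prod>x\<in>B. exp (c * mean_prob w x))"
  proof (intro mult_left_mono prod_mono conjI exp_ge_add_one_self measure_nonneg pos)
    fix x
    show "0 \<le> mean_prob w x" unfolding mean_prob_def
      by (intro Bochner_Integration.integral_nonneg_AE AE_I2 edge_prob_bounds w weight_nonneg)
    have "mean_prob w x \<le> (\<integral>\<omega>. 1 \<partial>M)" unfolding mean_prob_def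
      using w weight_nonneg edge_prob_bounds
      by (intro integral_mono integrable_const_bound[where B = 1]) auto
    then show "mean_prob w x \<le> 1" by (simp add: prob_space)
  qed
  also have "(\<Prod>x\<in>B. exp (c * mean_prob w x)) = exp (c * (\<Sum>x\<in>B. mean_prob w x))"
    using B by (simp add: exp_sum sum_distrib_left)
  finally show ?thesis .
qed

lemma exp_degree_in:
  assumes "finite B" "\<omega> \<in> space M"
  shows "exp (t * real (degree_in B \<omega>)) = (\<Prod>x\<in>B. 1 + (exp t - 1) * indicator (edge_event x) \<omega>)"
proof -
  have "(\<Prod>x\<in>B. 1 + (exp t - 1) * indicator (edge_event x) \<omega>) = (\<Prod>x\<in>B. if {0, x} \<in> G \<omega> then exp t else 1)"
    using assms by (intro prod.cong) (auto simp: edge_event_def)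
  also have "\<dots> = (\<Prod>x | x \<in> B \<and> {0, x} \<in> G \<omega>. exp t)"
    by (rule prod.inter_filter[OF assms(1), symmetric])
  also have "\<dots> = exp (t * real (degree_in B \<omega>))"
    by (simp add: degree_in_def exp_of_nat2_mult)
  finally show ?thesis by simp
qed

lemma degree_in_measurable [measurable]:
  assumes "finite B" "0 \<notin> B"
  shows "(\<lambda>\<omega>. real (degree_in B \<omega>)) \<in> borel_measurable M"
proof -
  have "real (degree_in B \<omega>) = (\<Sum>x\<in>B. indicator (edge_event x) \<omega>)" if "\<omega> \<in> space M" for \<omega>
  proof -
    have "(\<Sum>x\<in>B. indicator (edge_event x) \<omega>) = (\<Sum>x\<in>B. if {0, x} \<in> G \<omega> then 1 else 0 :: real)"
      using that by (intro sum.cong) (auto simp: edge_event_def)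
    also have "\<dots> = (\<Sum>x | x \<in> B \<and> {0, x} \<in> G \<omega>. 1)"
      by (rule sum.inter_filter[OF assms(1), symmetric])
    finally show ?thesis by (simp add: degree_in_def)
  qed
  moreover have "(\<lambda>\<omega>. \<Sum>x\<in>B. indicator (edge_event x) \<omega> :: real) \<in> borel_measurable M"
    using assms by (intro borel_measurable_sum borel_measurable_indicator edge_event_sets) auto
  ultimately show ?thesis by (simp cong: measurable_cong)
qed

text \<open>Markov's inequality for \<open>exp (t D)\<close>. Positive \<open>t\<close> controls a large degree, negative \<open>t\<close> a small
  one.\<close>

lemma degree_chernoff:
  assumes A: "A \<in> sets borel" and B: "finite B" "0 \<notin> B" and w: "0 \<le> w"
    and cmp: "\<And>v. v \<in> A \<Longrightarrow> (exp t - 1) * v \<le> (exp t - 1) * w"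
  shows "prob {\<omega> \<in> space M. W 0 \<omega> \<in> A \<and> t * s \<le> t * real (degree_in B \<omega>)}
    \<le> prob {\<omega> \<in> space M. W 0 \<omega> \<in> A} * exp ((exp t - 1) * (\<Sum>x\<in>B. mean_prob w x) - t * s)"
proof -
  note [measurable] = degree_in_measurable[OF B] A
  let ?X = "{\<omega> \<in> space M. W 0 \<omega> \<in> A \<and> t * s \<le> t * real (degree_in B \<omega>)}"
  let ?g = "indicator {\<omega> \<in> space M. W 0 \<omega> \<in> A} :: 'a \<Rightarrow> real"
  have cle: "real (degree_in B \<omega>) \<le> real (card B)" for \<omega>
    unfolding degree_in_def using B by (intro of_nat_mono card_mono) auto
  have "prob ?X = (\<integral>\<omega>. indicator ?X \<omega> \<partial>M)" by (simp add: Int_absorb2 Collect_restrict)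
  also have "\<dots> \<le> (\<integral>\<omega>. exp (- t * s) * (?g \<omega> * exp (t * real (degree_in B \<omega>))) \<partial>M)"
  proof (rule Bochner_Integration.integral_mono')
    show "integrable M (\<lambda>\<omega>. exp (- t * s) * (?g \<omega> * exp (t * real (degree_in B \<omega>))))"
    proof (rule integrable_mult_right, rule integrable_const_bound[where B = "exp (\<bar>t\<bar> * real (card B))"])
      have "t * real (degree_in B \<omega>) \<le> \<bar>t\<bar> * real (card B)" for \<omega>
        using cle[of \<omega>] by (intro mult_mono) auto
      then show "AE \<omega> in M. norm (?g \<omega> * exp (t * real (degree_in B \<omega>))) \<le> exp (\<bar>t\<bar> * real (card B))"
        by (intro AE_I2) (auto split: split_indicator)
    qed measurable
    fix \<omega> assume "\<omega> \<in> space M"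
    show "0 \<le> exp (- t * s) * (?g \<omega> * exp (t * real (degree_in B \<omega>)))" by simp
    show "indicator ?X \<omega> \<le> exp (- t * s) * (?g \<omega> * exp (t * real (degree_in B \<omega>)))"
      by (auto split: split_indicator simp flip: exp_add)
  qed
  also have "\<dots> = exp (- t * s) * (\<integral>\<omega>. ?g \<omega> * (\<Prod>x\<in>B. 1 + (exp t - 1) * indicator (edge_event x) \<omega>) \<partial>M)"
    by (simp add: exp_degree_in[OF B(1)] cong: Bochner_Integration.integral_cong)
  also have "\<dots> \<le> exp (- t * s) * (prob {\<omega> \<in> space M. W 0 \<omega> \<in> A} * exp ((exp t - 1) * (\<Sum>x\<in>B. mean_prob w x)))"
    by (intro mult_left_mono generating_function_bound A B w cmp) auto
  also have "\<dots> = prob {\<omega> \<in> space M. W 0 \<omega> \<in> A} * exp ((exp t - 1) * (\<Sum>x\<in>B. mean_prob w x) - t * s)"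
    by (simp add: mult_ac flip: exp_add)
  finally show ?thesis .
qed

text \<open>The equivalence covers infinitely many neighbours too: then the degrees inside the boxes are
  unbounded.\<close>

lemma degree_gt_iff:
  assumes "\<omega> \<in> space M"
  shows "ereal_of_enat (vertex_degree (G \<omega>) 0) > ereal s \<longleftrightarrow> (\<exists>n. real (degree_in (lattice_box n) \<omega>) > s)"
proof -
  let ?N = "{y. y \<noteq> 0 \<and> {0, y} \<in> G \<omega>}"
  have box: "finite (lattice_box n :: (int ^ 'd) set)" "0 \<notin> (lattice_box n :: (int ^ 'd) set)" for n
    using finite_lattice_box by (auto simp: lattice_box_def)
  have sub: "{x \<in> lattice_box n. {0, x} \<in> G \<omega>} \<subseteq> ?N" for n using box(2)[of n] by auto
  have large: "\<exists>n. real (degree_in (lattice_box n) \<omega>) \<ge> real (card S)" if "finite S" "S \<subseteq> ?N" for S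
  proof -
    have "\<forall>\<^sub>F n in sequentially. S \<subseteq> lattice_box n"
      using that by (intro lattice_box_exhausts) auto
    then obtain n where "S \<subseteq> lattice_box n" by (auto simp: eventually_sequentially)
    then have "card S \<le> degree_in (lattice_box n) \<omega>"
      unfolding degree_in_def using that box(1)[of n] by (intro card_mono) auto
    then show ?thesis by auto
  qed
  show ?thesis
  proof (cases "finite ?N")
    case True
    have "(\<exists>n. real (degree_in (lattice_box n) \<omega>) > s) \<longleftrightarrow> real (card ?N) > s"
    proof
      assume "\<exists>n. real (degree_in (lattice_box n) \<omega>) > s"
      moreover have "degree_in (lattice_box n) \<omega> \<le> card ?N" for n
        unfolding degree_in_def by (intro card_mono True sub)
      ultimately show "real (card ?N) > s" by (meson less_le_trans of_nat_mono)
    next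
      assume "real (card ?N) > s"
      then show "\<exists>n. real (degree_in (lattice_box n) \<omega>) > s"
        using large[OF True order_refl] by (meson less_le_trans)
    qed
    with True show ?thesis by (simp add: vertex_degree_def)
  next
    case False
    obtain k :: nat where k: "s < real k" using reals_Archimedean2 by blast
    obtain S where S: "finite S" "card S = k" "S \<subseteq> ?N" using infinite_arbitrarily_large[OF False] by blast
    obtain n where "real (card S) \<le> real (degree_in (lattice_box n) \<omega>)" using large[OF S(1,3)] by blast
    then have "s < real (degree_in (lattice_box n) \<omega>)" using k S(2) by simp
    then have "\<exists>n. real (degree_in (lattice_box n) \<omega>) > s" by blast
    with False show ?thesis by (simp add: vertex_degree_def)
  qed
qed

text \<open>Either the weight \<open>W\<^sub>0\<close> exceeds \<open>w\<close>, or the degree is unusually large for a weight at most \<open>w\<close>;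
  conversely, a weight above \<open>w\<close> forces the degree above \<open>s\<close> unless it is unusually small. The
  bounds hold for the degree inside each box and pass to the limit.\<close>

lemma degree_tail_bounds:
  fixes m :: "real \<Rightarrow> real"
  defines "h \<equiv> \<lambda>w. prob {\<omega> \<in> space M. W 0 \<omega> > w}"
    and "P \<equiv> \<lambda>s. prob {\<omega> \<in> space M. ereal_of_enat (vertex_degree (G \<omega>) 0) > ereal s}"
  assumes t: "0 < t" and w: "0 \<le> w"
    and le: "\<And>n. (\<Sum>x\<in>lattice_box n. mean_prob w x) \<le> m w"
    and lim: "(\<lambda>n. \<Sum>x\<in>lattice_box n. mean_prob w x) \<longlonglongrightarrow> m w"
  shows "P s \<le> h w + exp ((exp t - 1) * m w - t * s)"
    and "h w * (1 - exp (t * s - (1 - exp (- t)) * m w)) \<le> P s"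
proof -
  have box: "finite (lattice_box n :: (int ^ 'd) set)" "0 \<notin> (lattice_box n :: (int ^ 'd) set)" for n
    using finite_lattice_box by (auto simp: lattice_box_def)
  note [measurable] = degree_in_measurable[OF box]
  define D where "D n = {\<omega> \<in> space M. real (degree_in (lattice_box n) \<omega>) > s}" for n
  have DM [measurable]: "D n \<in> sets M" for n unfolding D_def by measurable
  have inc: "incseq D"
  proof (intro monoI subsetI)
    fix n k :: nat and \<omega> assume "n \<le> k" "\<omega> \<in> D n"
    moreover from \<open>n \<le> k\<close> have "degree_in (lattice_box n) \<omega> \<le> degree_in (lattice_box k) \<omega>" 
      unfolding degree_in_def
      by (intro card_mono finite_Collect_conjI disjI1) (auto simp: lattice_box_def box(1)[unfolded lattice_box_def])
    ultimately show "\<omega> \<in> D k" by (auto simp: D_def)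
  qed
  have "(\<lambda>n. prob (D n)) \<longlonglongrightarrow> prob (\<Union>n. D n)"
    using inc by (intro finite_Lim_measure_incseq) auto
  moreover have "(\<Union>n. D n) = {\<omega> \<in> space M. ereal_of_enat (vertex_degree (G \<omega>) 0) > ereal s}"
    using degree_gt_iff by (auto simp: D_def)
  ultimately have PD: "(\<lambda>n. prob (D n)) \<longlonglongrightarrow> P s" by (simp add: P_def)
  have DP: "prob (D n) \<le> P s" for n
    by (rule incseq_le[OF _ PD]) (use inc in \<open>auto intro!: monoI finite_measure_mono dest: incseqD\<close>)
  show "P s \<le> h w + exp ((exp t - 1) * m w - t * s)"
  proof (rule LIMSEQ_le_const2[OF PD], intro exI allI impI)
    fix n
    let ?X = "{\<omega> \<in> space M. W 0 \<omega> \<in> {..w} \<and> t * s \<le> t * real (degree_in (lattice_box n) \<omega>)}"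
    have "prob (D n) \<le> prob ({\<omega> \<in> space M. W 0 \<omega> > w} \<union> ?X)"
      by (intro finite_measure_mono) (auto simp: D_def not_less t)
    also have "\<dots> \<le> h w + prob ?X" unfolding h_def by (intro measure_Un_le) auto
    also have "prob ?X \<le> prob {\<omega> \<in> space M. W 0 \<omega> \<in> {..w}} * exp ((exp t - 1) * (\<Sum>x\<in>lattice_box n. mean_prob w x) - t * s)"
      using t by (intro degree_chernoff box w) (auto intro!: mult_left_mono)
    also have "\<dots> \<le> 1 * exp ((exp t - 1) * m w - t * s)"
      using t le[of n] by (intro mult_mono) (auto intro!: mult_left_mono)
    finally show "prob (D n) \<le> h w + exp ((exp t - 1) * m w - t * s)" by simp
  qed
  have low: "h w * (1 - exp (t * s - (1 - exp (- t)) * (\<Sum>x\<in>lattice_box n. mean_prob w x))) \<le> P s" for n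
  proof -
    let ?X = "{\<omega> \<in> space M. W 0 \<omega> \<in> {w<..} \<and> - t * s \<le> - t * real (degree_in (lattice_box n) \<omega>)}"
    let ?S = "\<Sum>x\<in>lattice_box n. mean_prob w x"
    have "h w \<le> prob (D n \<union> ?X)" unfolding h_def
      by (intro finite_measure_mono) (auto simp: D_def not_less t)
    also have "\<dots> \<le> prob (D n) + prob ?X" by (intro measure_Un_le) auto
    also have "prob ?X \<le> prob {\<omega> \<in> space M. W 0 \<omega> \<in> {w<..}} * exp ((exp (- t) - 1) * ?S - - t * s)"
      using t by (intro degree_chernoff box w) (auto intro!: mult_left_mono_neg)
    also have "\<dots> = h w * exp (t * s - (1 - exp (- t)) * ?S)"
      by (simp add: h_def algebra_simps)
    finally show ?thesis using DP[of n] by (simp add: algebra_simps)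
  qed
  show "h w * (1 - exp (t * s - (1 - exp (- t)) * m w)) \<le> P s"
    by (rule LIMSEQ_le_const2[of "\<lambda>n. h w * (1 - exp (t * s - (1 - exp (- t)) * (\<Sum>x\<in>lattice_box n. mean_prob w x)))"])
       (use low lim in \<open>auto intro!: tendsto_intros\<close>)
qed

end

section \<open>The tail of the degree\<close>

theorem theorem2p2:
  fixes M :: "'a measure"
    and W :: "int ^ 'd::finite \<Rightarrow> 'a \<Rightarrow> real"
    and G :: "'a \<Rightarrow> (int ^ 'd) set set"
    and F L :: "real \<Rightarrow> real"
    and lam \<alpha> \<tau> \<gamma> :: real
  assumes "prob_space M"
    and "lam > 0"
    and "\<alpha> > real CARD('d)"
    and "prob_space.indep_vars M (\<lambda>_. borel) W UNIV"
    and "\<And>x. cdf (distr M borel (W x)) = F"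
    and "\<And>x \<omega>. \<omega> \<in> space M \<Longrightarrow> 0 \<le> W x \<omega>"
    and "slowly_varying L"
    and "\<And>w. w > 0 \<Longrightarrow> 1 - F w = w powr (- (\<tau> - 1)) * L w"
    and "\<gamma> = \<alpha> * (\<tau> - 1) / real CARD('d)"
    and "\<gamma> > 1"
    and "\<And>\<omega>. \<omega> \<in> space M \<Longrightarrow> G \<omega> \<subseteq> potential_edges"
    and "cond_indep_events M (generated_sigma M W)
           (\<lambda>e. {\<omega> \<in> space M. e \<in> G \<omega>}) potential_edges"
    and "\<And>x y. x \<noteq> y \<Longrightarrow>
           (AE \<omega> in M. cond_prob_given M (generated_sigma M W) {\<omega> \<in> space M. {x, y} \<in> G \<omega>} \<omega> =
              1 - exp (- (lam * W x \<omega> * W y \<omega> / lattice_dist x y powr \<alpha>)))"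
  shows "\<exists>l. slowly_varying l \<and>
           (\<forall>s>0. measure M {\<omega> \<in> space M. ereal_of_enat (vertex_degree (G \<omega>) 0) > ereal s} =
              s powr (- \<gamma>) * l s)"
proof -
  interpret prob_space M by fact
  have W: "W x \<in> borel_measurable M" for x
    using assms(4) by (auto simp: indep_vars_def)
  have identical: "distr M borel (W x) = distr M borel (W 0)" for x
    using W assms(5) by (intro cdf_unique real_distribution_distr) auto
  interpret weighted_percolation M W G lam \<alpha>
    by unfold_locales (use assms identical in auto)
  define p where "p = real CARD('d) / \<alpha>"
  define h where "h w = prob {\<omega> \<in> space M. W 0 \<omega> > w}" for w
  have a0: "\<alpha> > 0" using alpha by (metis of_nat_0_le_iff order_le_less_trans)
  have p: "0 < p" using a0 by (simp add: p_def)
  have \<gamma>: "\<gamma> = (\<tau> - 1) / p" using a0 assms(9) by (simp add: p_def)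
  then have p\<beta>: "p < \<tau> - 1" using mult_strict_right_mono[OF assms(10) p] p by simp
  have hL: "h w = w powr (- (\<tau> - 1)) * L w" if "w > 0" for w
  proof -
    have "F w = measure (distr M borel (W 0)) {..w}" by (simp add: cdf_def flip: assms(5)[of 0])
    also have "\<dots> = prob {\<omega> \<in> space M. W 0 \<omega> \<le> w}"
      by (subst measure_distr) (auto simp: vimage_def Int_def conj_commute)
    also have "\<dots> = 1 - h w"
    proof -
      have "{\<omega> \<in> space M. W 0 \<omega> \<le> w} = space M - {\<omega> \<in> space M. W 0 \<omega> > w}" by auto
      then show ?thesis unfolding h_def by (simp add: prob_compl)
    qed
    finally show ?thesis using assms(8)[OF that] by simp
  qed
  have Lpos: "\<forall>\<^sub>F w in at_top. 0 < L w" using assms(7) by (simp add: slowly_varying_def)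
  have pos: "\<forall>\<^sub>F w in at_top. 0 < h w"
    using Lpos eventually_gt_at_top[of 0] by eventually_elim (simp add: hL)
  have anti: "h y \<le> h x" if "0 < x" "x \<le> y" for x y
    unfolding h_def using that by (intro finite_measure_mono) auto
  have rv: "((\<lambda>w. h (b * w) / h w) \<longlongrightarrow> b powr (- (\<tau> - 1))) at_top" if b: "b > 0" for b
  proof -
    have "((\<lambda>w. b powr (- (\<tau> - 1)) * (L (b * w) / L w)) \<longlongrightarrow> b powr (- (\<tau> - 1)) * 1) at_top"
      using assms(7) b by (intro tendsto_intros) (simp add: slowly_varying_def)
    moreover have "\<forall>\<^sub>F w in at_top. b powr (- (\<tau> - 1)) * (L (b * w) / L w) = h (b * w) / h w"
      using eventually_gt_at_top[of 0] by eventually_elim (use b in \<open>simp add: hL powr_mult\<close>)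
    ultimately have "((\<lambda>w. h (b * w) / h w) \<longlongrightarrow> b powr (- (\<tau> - 1)) * 1) at_top"
      by (rule Lim_transform_eventually)
    then show ?thesis by simp
  qed
  have "integrable M (\<lambda>\<omega>. W 0 \<omega> powr p)"
    by (rule integrable_powr_of_regular_tail[OF prob_space_axioms W weight_nonneg h_def pos rv p p\<beta>]) auto
  then have "integrable M (\<lambda>\<omega>. (lam * W 0 \<omega>) powr p)"
    using integrable_mult_right[of "lam powr p" M "\<lambda>\<omega>. W 0 \<omega> powr p"] lam weight_nonneg
    by (simp add: powr_mult cong: Bochner_Integration.integrable_cong)
  \<comment> \<open>Otherwise the constant \<open>C\<close> would vanish.\<close>
  moreover have "\<not> (AE \<omega> in M. lam * W 0 \<omega> = 0)"
  proof
    assume "AE \<omega> in M. lam * W 0 \<omega> = 0"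
    then have ae: "AE \<omega> in M. W 0 \<omega> = 0" using lam by simp
    obtain w where w: "0 < h w" "0 < w"
      using eventually_happens'[OF _ eventually_conj[OF pos eventually_gt_at_top[of 0]]] by auto
    have "h w = prob {}" unfolding h_def
      by (rule finite_measure_eq_AE) (use ae w(2) in auto)
    with w(1) show False by simp
  qed
  ultimately obtain m C where C: "0 < C" "((\<lambda>w. m w / w powr p) \<longlongrightarrow> C) at_top"
    and m: "\<And>w. w \<ge> 0 \<Longrightarrow> (\<forall>n. (\<Sum>x\<in>lattice_box n. mean_prob w x) \<le> m w) \<and>
      (\<lambda>n. \<Sum>x\<in>lattice_box n. mean_prob w x) \<longlonglongrightarrow> m w"
    using expected_degree[OF prob_space_axioms alpha, of "\<lambda>\<omega>. lam * W 0 \<omega>"] lam weight_nonneg W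
    unfolding p_def mean_prob_def edge_prob_def by auto
  show ?thesis unfolding \<gamma>
    by (rule regular_tail_transfer[OF p C(1) anti pos rv C(2)])
       (use m in \<open>auto simp: h_def intro!: degree_tail_bounds\<close>)
qed

end
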